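(* Let $(G,m)$ be a summable weighted graph without isolated vertices, and let $\Delta$ be its normalised Laplacian on $L^2(G,m)$. Then \[ 1-\sqrt{1-h(G,m)^2}\;\le\;\lambda_{gap}(\Delta)\;\le\;2\,h(G,m), \] \[ 2\,\overline{h}(G,m)\;\le\;\lambda_{top}(\Delta)\;\le\;1+\sqrt{1-\big(1-\overline{h}(G,m)\big)^2}. \]
   Context: A weighted graph $(G,m)$ consists of a countable simple graph $G$ (vertex set $V(G)$ finite or countably infinite, edge set $E(G)$ a set of 2-element subsets of $V(G)$) and a function $m:E(G)\to(0,\infty)$; it is summable if $\sum_{e\in E(G)}m(e)<\infty$. Write $m(vw)=m(\{v,w\})$ if $\{v,w\}\in E(G)$ and $m(vw)=0$ otherwise. For a vertex $v$, $m(v)=\sum_{w}m(vw)$ (it is assumed no vertex is isolated, so $m(v)>0$), and for $S\subset V(G)$, $m(S)=\sum_{v\in S}m(v)$. $L^2(G,m)$ is the real Hilbert space of $f:V(G)\to\mathbb R$ with $\sum_v m(v)f(v)^2<\infty$, with inner product $\langle f,g\rangle=\sum_v m(v)f(v)g(v)$. The normalised Laplacian is $(\Delta f)(v)=f(v)-\sum_{w}\frac{m(vw)}{m(v)}f(w)$; $\sigma(\Delta)$ denotes its spectrum, $\lambda_{gap}(\Delta)=\inf\{\lambda\in\sigma(\Delta):\lambda>0\}$ and $\lambda_{top}(\Delta)=\sup\sigma(\Delta)$. For $S\subset V(G)$, $\partial S$ is the set of edges with exactly one endpoint in $S$, $m(\partial S)=\sum_{e\in\partial S}m(e)$, $S^c=V(G)\setminus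 S$, and for nonempty $S$ the Cheeger ratio is $h(S)=m(\partial S)/m(S)$. The Cheeger constant $h(G,m)$ is the infimum of $h(S)$ over all nonempty $S\subset V(G)$ with $m(S)\le m(S^c)$. For disjoint $A,B\subset V(G)$, $m(A,B)$ is the total weight of edges with one endpoint in $A$ and the other in $B$; for disjoint nonempty $A,B$, $\overline{h}(A,B)=\frac{2m(A,B)}{m(A)+m(B)}$, and the dual Cheeger constant $\overline{h}(G,m)$ is the supremum of $\overline{h}(A,B)$ over all pairs of disjoint nonempty subsets $A,B\subset V(G)$.
   Formalization: The bound λ_gap ≤ 2h is proved only for connected G, since it fails in general: two disjoint unit edges have λ_gap = 2 but h = 0. The other three inequalities need no connectedness. G is assumed to have at least one vertex. *)

theory Defs
  imports "HOL-Analysis.Analysis"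
begin

locale weighted_graph =
  fixes V :: "'v set" and E :: "'v set set" and m :: "'v set \<Rightarrow> real"
  assumes countable_vertices: "countable V"
    and edge_subset: "e \<in> E \<Longrightarrow> e \<subseteq> V"
    and edge_card: "e \<in> E \<Longrightarrow> card e = 2"
    and weight_pos: "e \<in> E \<Longrightarrow> m e > 0"

locale summable_weighted_graph = weighted_graph +
  assumes weight_summable: "m summable_on E"

definition no_isolated_vertices :: "'v set \<Rightarrow> 'v set set \<Rightarrow> bool" where
  "no_isolated_vertices V E \<longleftrightarrow> (\<forall>v\<in>V. \<exists>e\<in>E. v \<in> e)"

definition connected_graph :: "'v set \<Rightarrow> 'v set set \<Rightarrow> bool" where
  "connected_graph V E \<longleftrightarrow> (\<forall>u\<in>V. \<forall>v\<in>V. (u, v) \<in> {(x, y). {x, y} \<in> E}\<^sup>*)"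

definition pair_weight :: "'v set set \<Rightarrow> ('v set \<Rightarrow> real) \<Rightarrow> 'v \<Rightarrow> 'v \<Rightarrow> real" where
  "pair_weight E m v w = (if {v, w} \<in> E then m {v, w} else 0)"

definition vertex_weight :: "'v set \<Rightarrow> 'v set set \<Rightarrow> ('v set \<Rightarrow> real) \<Rightarrow> 'v \<Rightarrow> real" where
  "vertex_weight V E m v = (\<Sum>\<^sub>\<infinity>w\<in>V. pair_weight E m v w)"

definition set_weight :: "'v set \<Rightarrow> 'v set set \<Rightarrow> ('v set \<Rightarrow> real) \<Rightarrow> 'v set \<Rightarrow> real" where
  "set_weight V E m S = (\<Sum>\<^sub>\<infinity>v\<in>S. vertex_weight V E m v)"

text \<open>Functions on \<open>V\<close> are represented by functions on the ambient type that vanish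
  outside \<open>V\<close>, so that equality in \<open>L2\<close> is equality on \<open>V\<close>.\<close>

definition L2 :: "'v set \<Rightarrow> 'v set set \<Rightarrow> ('v set \<Rightarrow> real) \<Rightarrow> ('v \<Rightarrow> real) set" where
  "L2 V E m = {f. (\<forall>v. v \<notin> V \<longrightarrow> f v = 0) \<and>
                  (\<lambda>v. vertex_weight V E m v * (f v)\<^sup>2) summable_on V}"

definition L2_inner ::
  "'v set \<Rightarrow> 'v set set \<Rightarrow> ('v set \<Rightarrow> real) \<Rightarrow> ('v \<Rightarrow> real) \<Rightarrow> ('v \<Rightarrow> real) \<Rightarrow> real" where
  "L2_inner V E m f g = (\<Sum>\<^sub>\<infinity>v\<in>V. vertex_weight V E m v * f v * g v)"

definition L2_norm :: "'v set \<Rightarrow> 'v set set \<Rightarrow> ('v set \<Rightarrow> real) \<Rightarrow> ('v \<Rightarrow> real) \<Rightarrow> real" where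
  "L2_norm V E m f = sqrt (L2_inner V E m f f)"

definition L2_bounded_operator ::
  "'v set \<Rightarrow> 'v set set \<Rightarrow> ('v set \<Rightarrow> real) \<Rightarrow> (('v \<Rightarrow> real) \<Rightarrow> ('v \<Rightarrow> real)) \<Rightarrow> bool" where
  "L2_bounded_operator V E m T \<longleftrightarrow>
     (\<forall>f\<in>L2 V E m. T f \<in> L2 V E m) \<and>
     (\<forall>f\<in>L2 V E m. \<forall>g\<in>L2 V E m. \<forall>a b.
        T (\<lambda>v. a * f v + b * g v) = (\<lambda>v. a * T f v + b * T g v)) \<and>
     (\<exists>C. \<forall>f\<in>L2 V E m. L2_norm V E m (T f) \<le> C * L2_norm V E m f)"

definition L2_spectrum ::
  "'v set \<Rightarrow> 'v set set \<Rightarrow> ('v set \<Rightarrow> real) \<Rightarrow> (('v \<Rightarrow> real) \<Rightarrow> ('v \<Rightarrow> real)) \<Rightarrow> real set" where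
  "L2_spectrum V E m A = {\<mu>. \<not> (\<exists>R. L2_bounded_operator V E m R \<and>
     (\<forall>f\<in>L2 V E m. R (\<lambda>v. A f v - \<mu> * f v) = f \<and>
                    (\<lambda>v. A (R f) v - \<mu> * R f v) = f))}"

definition laplacian ::
  "'v set \<Rightarrow> 'v set set \<Rightarrow> ('v set \<Rightarrow> real) \<Rightarrow> ('v \<Rightarrow> real) \<Rightarrow> ('v \<Rightarrow> real)" where
  "laplacian V E m f v =
     (if v \<in> V
      then f v - (\<Sum>\<^sub>\<infinity>w\<in>V. pair_weight E m v w / vertex_weight V E m v * f w)
      else 0)"

definition lambda_gap :: "'v set \<Rightarrow> 'v set set \<Rightarrow> ('v set \<Rightarrow> real) \<Rightarrow> real" where
  "lambda_gap V E m = Inf {\<mu> \<in> L2_spectrum V E m (laplacian V E m). \<mu> > 0}"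

definition lambda_top :: "'v set \<Rightarrow> 'v set set \<Rightarrow> ('v set \<Rightarrow> real) \<Rightarrow> real" where
  "lambda_top V E m = Sup (L2_spectrum V E m (laplacian V E m))"

definition edge_boundary :: "'v set set \<Rightarrow> 'v set \<Rightarrow> 'v set set" where
  "edge_boundary E S = {e \<in> E. card (e \<inter> S) = 1}"

definition cheeger_ratio ::
  "'v set \<Rightarrow> 'v set set \<Rightarrow> ('v set \<Rightarrow> real) \<Rightarrow> 'v set \<Rightarrow> real" where
  "cheeger_ratio V E m S = (\<Sum>\<^sub>\<infinity>e\<in>edge_boundary E S. m e) / set_weight V E m S"

definition cheeger_constant :: "'v set \<Rightarrow> 'v set set \<Rightarrow> ('v set \<Rightarrow> real) \<Rightarrow> real" where
  "cheeger_constant V E m =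
     Inf {cheeger_ratio V E m S | S.
            S \<subseteq> V \<and> S \<noteq> {} \<and> set_weight V E m S \<le> set_weight V E m (V - S)}"

definition between_weight ::
  "'v set set \<Rightarrow> ('v set \<Rightarrow> real) \<Rightarrow> 'v set \<Rightarrow> 'v set \<Rightarrow> real" where
  "between_weight E m A B = (\<Sum>\<^sub>\<infinity>e\<in>{e \<in> E. \<exists>a\<in>A. \<exists>b\<in>B. e = {a, b}}. m e)"

definition dual_cheeger_ratio ::
  "'v set \<Rightarrow> 'v set set \<Rightarrow> ('v set \<Rightarrow> real) \<Rightarrow> 'v set \<Rightarrow> 'v set \<Rightarrow> real" where
  "dual_cheeger_ratio V E m A B =
     2 * between_weight E m A B / (set_weight V E m A + set_weight V E m B)"

definition dual_cheeger_constant :: "'v set \<Rightarrow> 'v set set \<Rightarrow> ('v set \<Rightarrow> real) \<Rightarrow> real" where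
  "dual_cheeger_constant V E m =
     Sup {dual_cheeger_ratio V E m A B | A B.
            A \<subseteq> V \<and> B \<subseteq> V \<and> A \<noteq> {} \<and> B \<noteq> {} \<and> A \<inter> B = {}}"

end

theory Submission
  imports Defs
begin

text \<open>
  After rescaling by the square root of the vertex weights, the Laplacian becomes a bounded symmetric
  operator \<open>T\<close> on a closed subspace of \<open>\<ell>\<^sup>2\<close>. A bounded below symmetric operator is invertible
  (contraction principle applied to its square), so a real number lies in the spectrum iff it is an
  approximate eigenvalue, and the top of the quadratic form belongs to the spectrum. If the spectrum
  misses \<open>(0, \<epsilon>)\<close>, then \<open>T\<^sup>2 - \<epsilon> T\<close> has a nonnegative form, from which \<open>T \<ge> \<epsilon>\<close> on the
  orthogonal complement of the kernel, without recourse to the spectral theorem. This reduces all four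
  inequalities to bounds for the Dirichlet form. The Cheeger bounds on the form come from a layer-cake
  (co-area) argument for the squares of the positive and negative parts of the function, shifted by a
  median in the case of the gap, and Cauchy-Schwarz over the edges; the remaining two bounds come from
  indicator test functions.
\<close>

section \<open>Square-summable functions\<close>

text \<open>The delicate estimate is the upper bound for the gap. A test function orthogonal to the
  constants controls an infimum of Rayleigh quotients, whereas \<open>lambda_gap\<close> is an
  infimum of spectral points, so a gap in the spectrum has to be converted into a lower bound for
  the form. For the two bounds of Cheeger type the easy converse suffices: a bound for the form
  keeps a number out of the spectrum. The conversion speaks about the orthogonal complement of the
  kernel, and connectedness makes that kernel consist of the constants. In a disconnected graph a
  component, or its complement, is admissible with empty boundary, so \<open>h = 0\<close>, while
  the positive spectrum may stay away from 0: two disjoint edges have spectrum {0, 2}. Hence the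
  upper bound for the gap is stated for connected graphs.\<close>

lemma summable_on_mult_of_squares:
  fixes x y :: "'a \<Rightarrow> real"
  assumes "(\<lambda>i. (x i)\<^sup>2) summable_on A" "(\<lambda>i. (y i)\<^sup>2) summable_on A"
  shows "(\<lambda>i. x i * y i) summable_on A"
proof -
  have "(\<lambda>i. norm (x i * y i)) summable_on A"
  proof (rule summable_on_comparison_test)
    show "(\<lambda>i. (x i)\<^sup>2 + (y i)\<^sup>2) summable_on A" by (rule summable_on_add[OF assms])
    show "norm (x i * y i) \<le> (x i)\<^sup>2 + (y i)\<^sup>2" for i
    proof -
      have "2 * (\<bar>x i\<bar> * \<bar>y i\<bar>) \<le> (x i)\<^sup>2 + (y i)\<^sup>2"
        using sum_squares_bound[of "\<bar>x i\<bar>" "\<bar>y i\<bar>"] by (simp add: mult.assoc)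
      moreover have "0 \<le> \<bar>x i\<bar> * \<bar>y i\<bar>" by simp
      ultimately show ?thesis unfolding real_norm_def abs_mult by linarith
    qed
  qed auto
  then show ?thesis using summable_on_iff_abs_summable_on_real by blast
qed

lemma summable_on_square_add:
  fixes x y :: "'a \<Rightarrow> real"
  assumes "(\<lambda>i. (x i)\<^sup>2) summable_on A" "(\<lambda>i. (y i)\<^sup>2) summable_on A"
  shows "(\<lambda>i. (x i + y i)\<^sup>2) summable_on A"
proof -
  have "(\<lambda>i. (x i)\<^sup>2 + (y i)\<^sup>2 + 2 * (x i * y i)) summable_on A"
    by (intro summable_on_add summable_on_cmult_right summable_on_mult_of_squares assms)
  then show ?thesis by (simp add: power2_sum mult.assoc)
qed

lemma summable_on_square_cmult:
  fixes x :: "'a \<Rightarrow> real"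
  assumes "(\<lambda>i. (x i)\<^sup>2) summable_on A"
  shows "(\<lambda>i. (c * x i)\<^sup>2) summable_on A"
  using summable_on_cmult_right[OF assms, of "c\<^sup>2"] by (simp add: power_mult_distrib)

text \<open>The weighted space depends on \<open>V\<close>, \<open>E\<close> and \<open>m\<close>,
  so it cannot itself be a type. An unweighted copy can be an instance of \<open>real_inner\<close>
  and \<open>complete_space\<close>, which gives access to norms, limits and the Banach fixed point
  theorem.\<close>

typedef 'a ell2 = "{x :: 'a \<Rightarrow> real. (\<lambda>i. (x i)\<^sup>2) summable_on UNIV}"
  morphisms ell2_nth Abs_ell2
  by (intro exI[of _ "\<lambda>_. 0"]) simp

setup_lifting type_definition_ell2

lemma ell2_eqI: "(\<And>i. ell2_nth x i = ell2_nth y i) \<Longrightarrow> x = y"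
  by transfer auto

lemma ell2_nth_square_summable: "(\<lambda>i. (ell2_nth x i)\<^sup>2) summable_on UNIV"
  by transfer

instantiation ell2 :: (type) real_inner
begin

lift_definition zero_ell2 :: "'a ell2" is "\<lambda>_. 0" by simp

lift_definition plus_ell2 :: "'a ell2 \<Rightarrow> 'a ell2 \<Rightarrow> 'a ell2" is "\<lambda>x y i. x i + y i"
  by (rule summable_on_square_add)

lift_definition scaleR_ell2 :: "real \<Rightarrow> 'a ell2 \<Rightarrow> 'a ell2" is "\<lambda>c x i. c * x i"
  by (rule summable_on_square_cmult)

lift_definition uminus_ell2 :: "'a ell2 \<Rightarrow> 'a ell2" is "\<lambda>x i. - x i"
  by simp

definition minus_ell2 :: "'a ell2 \<Rightarrow> 'a ell2 \<Rightarrow> 'a ell2" where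
  "minus_ell2 x y = x + - y"

lift_definition inner_ell2 :: "'a ell2 \<Rightarrow> 'a ell2 \<Rightarrow> real" is "\<lambda>x y. \<Sum>\<^sub>\<infinity>i. x i * y i" .

definition norm_ell2 :: "'a ell2 \<Rightarrow> real" where "norm_ell2 x = sqrt (inner x x)"
definition sgn_ell2 :: "'a ell2 \<Rightarrow> 'a ell2" where "sgn_ell2 x = scaleR (inverse (norm x)) x"
definition dist_ell2 :: "'a ell2 \<Rightarrow> 'a ell2 \<Rightarrow> real" where "dist_ell2 x y = norm (x - y)"
definition uniformity_ell2 :: "('a ell2 \<times> 'a ell2) filter" where
  "uniformity_ell2 = (INF e\<in>{0<..}. principal {(x, y). dist x y < e})"
definition open_ell2 :: "'a ell2 set \<Rightarrow> bool" where
  "open_ell2 U \<longleftrightarrow> (\<forall>x\<in>U. eventually (\<lambda>(x', y). x' = x \<longrightarrow> y \<in> U) uniformity)"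

instance
proof
  fix x y z :: "'a ell2" and a b r :: real
  show "x + y + z = x + (y + z)" by transfer (auto simp: add.assoc)
  show "x + y = y + x" by transfer (auto simp: add.commute)
  show "0 + x = x" by transfer auto
  show "- x + x = 0" by transfer auto
  show "x - y = x + - y" by (rule minus_ell2_def)
  show "a *\<^sub>R (x + y) = a *\<^sub>R x + a *\<^sub>R y" by transfer (auto simp: algebra_simps)
  show "(a + b) *\<^sub>R x = a *\<^sub>R x + b *\<^sub>R x" by transfer (auto simp: algebra_simps)
  show "a *\<^sub>R b *\<^sub>R x = (a * b) *\<^sub>R x" by transfer (auto simp: mult.assoc)
  show "1 *\<^sub>R x = x" by transfer auto
  show "sgn x = scaleR (inverse (norm x)) x" by (rule sgn_ell2_def)
  show "dist x y = norm (x - y)" by (rule dist_ell2_def)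
  show "(uniformity :: ('a ell2 \<times> 'a ell2) filter) = (INF e\<in>{0<..}. principal {(x, y). dist x y < e})"
    by (rule uniformity_ell2_def)
  show "open U \<longleftrightarrow> (\<forall>x\<in>U. eventually (\<lambda>(x', y). x' = x \<longrightarrow> y \<in> U) uniformity)" for U :: "'a ell2 set"
    by (rule open_ell2_def)
  show "norm x = sqrt (inner x x)" by (rule norm_ell2_def)
  show "inner x y = inner y x" by transfer (simp add: mult.commute)
  show "inner (x + y) z = inner x z + inner y z"
    by transfer (simp add: distrib_right infsum_add summable_on_mult_of_squares)
  show "inner (r *\<^sub>R x) y = r * inner x y"
    by transfer (simp add: mult.assoc infsum_cmult_right')
  show "0 \<le> inner x x" by transfer (simp add: infsum_nonneg)
  show "inner x x = 0 \<longleftrightarrow> x = 0"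
  proof
    assume "inner x x = 0"
    then have "(\<Sum>\<^sub>\<infinity>i. (ell2_nth x i)\<^sup>2) = 0" by transfer (simp add: power2_eq_square)
    then have "(ell2_nth x i)\<^sup>2 = 0" for i
      by (intro nonneg_infsum_le_0D[OF _ ell2_nth_square_summable]) auto
    then show "x = 0" by (intro ell2_eqI) (simp add: zero_ell2.rep_eq)
  qed (transfer; simp)
qed

end

lemma ell2_nth_simps [simp]:
  "ell2_nth 0 i = 0"
  "ell2_nth (x + y) i = ell2_nth x i + ell2_nth y i"
  "ell2_nth (x - y) i = ell2_nth x i - ell2_nth y i"
  "ell2_nth (c *\<^sub>R x) i = c * ell2_nth x i"
  by (simp_all add: zero_ell2.rep_eq plus_ell2.rep_eq uminus_ell2.rep_eq scaleR_ell2.rep_eq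
      diff_conv_add_uminus del: add_uminus_conv_diff)

lemma norm_ell2_square: "(norm (x :: 'a ell2))\<^sup>2 = (\<Sum>\<^sub>\<infinity>i. (ell2_nth x i)\<^sup>2)"
  unfolding power2_norm_eq_inner by (simp add: inner_ell2.rep_eq power2_eq_square)

lemma abs_ell2_nth_le_norm: "\<bar>ell2_nth x i\<bar> \<le> norm x"
proof -
  have "(\<Sum>j\<in>{i}. (ell2_nth x j)\<^sup>2) \<le> (\<Sum>\<^sub>\<infinity>j. (ell2_nth x j)\<^sup>2)"
    by (intro finite_sum_le_infsum ell2_nth_square_summable) auto
  then have "\<bar>ell2_nth x i\<bar>\<^sup>2 \<le> (norm x)\<^sup>2" by (simp add: norm_ell2_square)
  then show ?thesis by (rule power2_le_imp_le) simp
qed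

lemma bounded_linear_ell2_nth: "bounded_linear (\<lambda>x. ell2_nth x i)"
  by (rule bounded_linear_intro[where K = 1]) (simp_all add: abs_ell2_nth_le_norm)

instance ell2 :: (type) complete_space
proof
  fix X :: "nat \<Rightarrow> 'a ell2"
  assume X: "Cauchy X"
  have "Cauchy (\<lambda>n. ell2_nth (X n) i)" for i
    by (rule bounded_linear.Cauchy[OF bounded_linear_ell2_nth X])
  then have "\<exists>l. (\<lambda>n. ell2_nth (X n) i) \<longlonglongrightarrow> l" for i
    by (simp add: Cauchy_convergent convergentD)
  then obtain l where l: "\<And>i. (\<lambda>n. ell2_nth (X n) i) \<longlonglongrightarrow> l i" by metis
  \<comment> \<open>The estimate passes to the limit in \<open>k\<close> over each finite set
    \<open>F\<close>; its bound does not depend on \<open>F\<close>, so it then extends to the full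
    sum.\<close>
  have tail: "(\<Sum>i\<in>F. (ell2_nth (X n) i - l i)\<^sup>2) \<le> e\<^sup>2"
    if "finite F" "e > 0" "\<And>k. k \<ge> N \<Longrightarrow> norm (X n - X k) \<le> e" for F e n N
  proof (rule LIMSEQ_le_const2)
    show "(\<lambda>k. \<Sum>i\<in>F. (ell2_nth (X n) i - ell2_nth (X k) i)\<^sup>2) \<longlonglongrightarrow> (\<Sum>i\<in>F. (ell2_nth (X n) i - l i)\<^sup>2)"
      by (intro tendsto_intros l)
    show "\<exists>N. \<forall>k\<ge>N. (\<Sum>i\<in>F. (ell2_nth (X n) i - ell2_nth (X k) i)\<^sup>2) \<le> e\<^sup>2"
    proof (intro exI[of _ N] allI impI)
      fix k assume "k \<ge> N"
      have "(\<Sum>i\<in>F. (ell2_nth (X n - X k) i)\<^sup>2) \<le> (norm (X n - X k))\<^sup>2"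
        unfolding norm_ell2_square
        by (intro finite_sum_le_infsum ell2_nth_square_summable that) auto
      also have "\<dots> \<le> e\<^sup>2" using that \<open>k \<ge> N\<close> by (intro power_mono) auto
      finally show "(\<Sum>i\<in>F. (ell2_nth (X n) i - ell2_nth (X k) i)\<^sup>2) \<le> e\<^sup>2" by simp
    qed
  qed
  have close: "(\<lambda>i. (ell2_nth (X n) i - l i)\<^sup>2) summable_on UNIV
      \<and> (\<Sum>\<^sub>\<infinity>i. (ell2_nth (X n) i - l i)\<^sup>2) \<le> e\<^sup>2"
    if "e > 0" "\<And>k. k \<ge> N \<Longrightarrow> norm (X n - X k) \<le> e" for e n N
  proof
    show s: "(\<lambda>i. (ell2_nth (X n) i - l i)\<^sup>2) summable_on UNIV"
      using tail[OF _ that] by (intro nonneg_bdd_above_summable_on bdd_aboveI[of _ "e\<^sup>2"]) auto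
    show "(\<Sum>\<^sub>\<infinity>i. (ell2_nth (X n) i - l i)\<^sup>2) \<le> e\<^sup>2"
      using tail[OF _ that] by (intro infsum_le_finite_sums s) auto
  qed
  obtain N1 where N1: "\<And>k. k \<ge> N1 \<Longrightarrow> norm (X N1 - X k) \<le> 1"
    using CauchyD[OF X, of 1] by (force intro: less_imp_le)
  \<comment> \<open>The limit is written as \<open>X N1\<close> minus the difference
    \<open>X N1 - l\<close>, both square-summable.\<close>
  have "(\<lambda>i. (ell2_nth (X N1) i + (- 1) * (ell2_nth (X N1) i - l i))\<^sup>2) summable_on UNIV"
    using close[OF _ N1]
    by (intro summable_on_square_add summable_on_square_cmult ell2_nth_square_summable) auto
  then have lsum: "(\<lambda>i. (l i)\<^sup>2) summable_on UNIV" by simp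
  define L where "L = Abs_ell2 l"
  have L: "ell2_nth L = l" unfolding L_def using lsum by (simp add: Abs_ell2_inverse)
  have "X \<longlonglongrightarrow> L"
  proof (rule LIMSEQ_I)
    fix e :: real assume "e > 0"
    then obtain N where N: "\<And>n k. n \<ge> N \<Longrightarrow> k \<ge> N \<Longrightarrow> norm (X n - X k) < e / 2"
      using CauchyD[OF X, of "e / 2"] by auto
    have "norm (X n - L) < e" if "n \<ge> N" for n
    proof -
      have "(norm (X n - L))\<^sup>2 \<le> (e / 2)\<^sup>2"
        using close[of "e / 2" N n] N[OF that] \<open>e > 0\<close> by (simp add: norm_ell2_square L less_imp_le)
      then have "norm (X n - L) \<le> e / 2" by (rule power2_le_imp_le) (use \<open>e > 0\<close> in simp)
      then show ?thesis using \<open>e > 0\<close> by simp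
    qed
    then show "\<exists>N. \<forall>n\<ge>N. norm (X n - L) < e" by blast
  qed
  then show "convergent X" by (rule convergentI)
qed

lemma infsum_Cauchy_Schwarz:
  fixes x y :: "'a \<Rightarrow> real"
  assumes "(\<lambda>i. (x i)\<^sup>2) summable_on UNIV" "(\<lambda>i. (y i)\<^sup>2) summable_on UNIV"
  shows "(\<Sum>\<^sub>\<infinity>i. x i * y i)\<^sup>2 \<le> (\<Sum>\<^sub>\<infinity>i. (x i)\<^sup>2) * (\<Sum>\<^sub>\<infinity>i. (y i)\<^sup>2)"
  using Cauchy_Schwarz_ineq[of "Abs_ell2 x" "Abs_ell2 y"] assms
  by (simp add: inner_ell2.rep_eq Abs_ell2_inverse power2_eq_square)

lemma complete_ell2_supported: "complete {x :: 'a ell2. \<forall>i. i \<notin> A \<longrightarrow> ell2_nth x i = 0}"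
proof -
  have "closed (\<Inter>i\<in>-A. {x. ell2_nth x i = 0})"
    by (intro closed_INT ballI closed_Collect_eq continuous_on_const
        linear_continuous_on bounded_linear_ell2_nth)
  also have "(\<Inter>i\<in>-A. {x. ell2_nth x i = 0}) = {x. \<forall>i. i \<notin> A \<longrightarrow> ell2_nth x i = 0}" by auto
  finally show ?thesis by (simp add: complete_eq_closed)
qed

section \<open>Spectral gaps of symmetric operators\<close>

text \<open>For \<open>B = T - \<mu>\<close> this says that \<open>\<mu>\<close> is not an
  approximate eigenvalue of \<open>T\<close> on \<open>H\<close>.\<close>

definition bounded_below_on :: "'a::real_normed_vector set \<Rightarrow> ('a \<Rightarrow> 'a) \<Rightarrow> bool" where
  "bounded_below_on H B \<longleftrightarrow> (\<exists>k>0. \<forall>x\<in>H. k * norm x \<le> norm (B x))"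

text \<open>A Lax-Milgram argument: a solution of \<open>B x = y\<close> is a fixed point of
  \<open>x - t *\<^sub>R (B x - y)\<close>, and coercivity makes this map a contraction for small
  \<open>t > 0\<close>.\<close>

lemma coercive_imp_surj:
  fixes B :: "'a::real_inner \<Rightarrow> 'a"
  assumes H: "subspace H" "complete H" and B: "bounded_linear B" "B ` H \<subseteq> H"
    and c: "c > 0" "\<And>x. x \<in> H \<Longrightarrow> c * (norm x)\<^sup>2 \<le> B x \<bullet> x" and y: "y \<in> H"
  shows "\<exists>x\<in>H. B x = y"
proof -
  obtain K where K: "K > 0" "\<And>x. norm (B x) \<le> norm x * K"
    using bounded_linear.pos_bounded[OF B(1)] by blast
  interpret B: bounded_linear B by (rule B(1))
  \<comment> \<open>Taking \<open>L\<close> at least \<open>c\<close> keeps the argument of the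
    square root in \<open>q\<close> nonnegative; \<open>t = c / L\<^sup>2\<close> minimises the
    squared Lipschitz bound \<open>1 - 2 * t * c + t\<^sup>2 * L\<^sup>2\<close>.\<close>
  define L where "L = max K c"
  have L: "L \<ge> c" "L > 0" "\<And>x. norm (B x) \<le> norm x * L"
    using K c(1) unfolding L_def by (auto intro!: order_trans[OF K(2)] mult_left_mono)
  define t where "t = c / L\<^sup>2"
  have t: "t > 0" using c L by (auto simp: t_def)
  define q where "q = sqrt (1 - c\<^sup>2 / L\<^sup>2)"
  have c2: "c\<^sup>2 / L\<^sup>2 \<le> 1" "c\<^sup>2 / L\<^sup>2 > 0" using c(1) L by (auto simp: divide_le_eq power_mono)
  have q: "0 \<le> q" "q < 1" using c2 unfolding q_def by (auto simp: real_sqrt_lt_1_iff)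
  have contr: "norm (x - t *\<^sub>R B x) \<le> q * norm x" if "x \<in> H" for x
  proof -
    have "(norm (x - t *\<^sub>R B x))\<^sup>2 = (norm x)\<^sup>2 - 2 * t * (B x \<bullet> x) + t\<^sup>2 * (norm (B x))\<^sup>2"
      unfolding power2_norm_eq_inner
      by (simp add: inner_diff_left inner_diff_right inner_commute power2_eq_square algebra_simps)
    also have "\<dots> \<le> (norm x)\<^sup>2 - 2 * t * (c * (norm x)\<^sup>2) + t\<^sup>2 * (norm x * L)\<^sup>2"
      using c(2)[OF that] L(3)[of x] t
      by (intro add_mono diff_left_mono mult_left_mono power_mono) auto
    also have "\<dots> = (1 - c\<^sup>2 / L\<^sup>2) * (norm x)\<^sup>2"
      using L(2) by (simp add: t_def field_simps power2_eq_square)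
    also have "\<dots> = (q * norm x)\<^sup>2"
      using c2 by (simp add: q_def power_mult_distrib)
    finally show ?thesis using q by (auto elim!: power2_le_imp_le)
  qed
  have "\<exists>!x\<in>H. x - t *\<^sub>R (B x - y) = x"
  proof (rule Banach_fix[OF H(2) _ q])
    show "H \<noteq> {}" using y by auto
    show "(\<lambda>x. x - t *\<^sub>R (B x - y)) ` H \<subseteq> H"
      using B(2) y by (auto intro!: subspace_diff[OF H(1)] subspace_scale[OF H(1)])
    fix x z assume xz: "x \<in> H" "z \<in> H"
    have "x - t *\<^sub>R (B x - y) - (z - t *\<^sub>R (B z - y)) = (x - z) - t *\<^sub>R B (x - z)"
      by (simp add: B.diff algebra_simps)
    then show "dist (x - t *\<^sub>R (B x - y)) (z - t *\<^sub>R (B z - y)) \<le> q * dist x z"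
      unfolding dist_norm using contr[OF subspace_diff[OF H(1) xz]] by (simp only:)
  qed
  then show ?thesis using t by auto
qed

text \<open>\<open>B\<close> may be indefinite and so not coercive itself, but symmetry gives
  \<open>B (B x) \<bullet> x = (norm (B x))\<^sup>2\<close>. Solving \<open>B (B z) = B y\<close>
  suffices, since the lower bound allows one \<open>B\<close> to be cancelled.\<close>

lemma symmetric_bounded_below_imp_surj:
  fixes B :: "'a::real_inner \<Rightarrow> 'a"
  assumes H: "subspace H" "complete H" and B: "bounded_linear B" "B ` H \<subseteq> H"
    and sym: "\<And>x y. B x \<bullet> y = x \<bullet> B y" and bb: "bounded_below_on H B" and y: "y \<in> H"
  shows "\<exists>x\<in>H. B x = y"
proof -
  obtain k where k: "k > 0" "\<And>x. x \<in> H \<Longrightarrow> k * norm x \<le> norm (B x)"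
    using bb unfolding bounded_below_on_def by blast
  have "k\<^sup>2 * (norm x)\<^sup>2 \<le> B (B x) \<bullet> x" if "x \<in> H" for x
  proof -
    have "(k * norm x)\<^sup>2 \<le> (norm (B x))\<^sup>2" using k that by (intro power_mono) auto
    then show ?thesis by (simp add: sym power2_norm_eq_inner power_mult_distrib)
  qed
  then have "\<exists>x\<in>H. B (B x) = B y"
    using k(1) y B bounded_linear_compose[OF B(1) B(1)]
    by (intro coercive_imp_surj[OF H, where B = "\<lambda>x. B (B x)" and c = "k\<^sup>2"])
       (auto simp: image_subset_iff)
  then obtain z where z: "z \<in> H" "B (B z) = B y" by auto
  have Bz: "B z \<in> H" using B z by auto
  have "B (B z - y) = 0" using z by (simp add: linear_diff[OF bounded_linear.linear[OF B(1)]])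
  then have "B z - y = 0"
    using k(1) k(2)[OF subspace_diff[OF H(1) Bz y]] by (simp add: mult_le_0_iff)
  then show ?thesis using z by auto
qed

section \<open>Nonnegative forms and the top of a form\<close>

text \<open>\<open>B x \<bullet> y\<close> is a semi-inner product on \<open>H\<close>, hence
  Cauchy-Schwarz. Its instance \<open>y = B x\<close> shows that a small value of the form forces
  \<open>B x\<close> itself to be small.\<close>

lemma psd_form_bounds:
  fixes B :: "'a::real_inner \<Rightarrow> 'a"
  assumes H: "subspace H" and B: "bounded_linear B" "B ` H \<subseteq> H"
    and sym: "\<And>x y. B x \<bullet> y = x \<bullet> B y" and pos: "\<And>x. x \<in> H \<Longrightarrow> 0 \<le> B x \<bullet> x"
  shows psd_form_Cauchy_Schwarz:
      "\<And>x y. x \<in> H \<Longrightarrow> y \<in> H \<Longrightarrow> (B x \<bullet> y)\<^sup>2 \<le> (B x \<bullet> x) * (B y \<bullet> y)"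
    and psd_norm_le_form:
      "\<And>K x. (\<And>x. norm (B x) \<le> K * norm x) \<Longrightarrow> x \<in> H \<Longrightarrow> (norm (B x))\<^sup>2 \<le> K * (B x \<bullet> x)"
proof -
  interpret B: bounded_linear B by (rule B(1))
  show CS: "(B x \<bullet> y)\<^sup>2 \<le> (B x \<bullet> x) * (B y \<bullet> y)" if xy: "x \<in> H" "y \<in> H" for x y
  proof -
    define a b d where "a = B x \<bullet> x" and "b = B x \<bullet> y" and "d = B y \<bullet> y"
    have q: "0 \<le> a + 2 * r * b + r\<^sup>2 * d" for r
    proof -
      have "x + r *\<^sub>R y \<in> H" using xy by (intro subspace_add[OF H] subspace_scale[OF H])
      from pos[OF this] show ?thesis
        using sym[of y x]
        by (simp add: B.add B.scale inner_add_left inner_add_right a_def b_def d_def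
            inner_commute power2_eq_square algebra_simps)
    qed
    have ad: "a \<ge> 0" "d \<ge> 0" using pos xy by (auto simp: a_def d_def)
    have "b\<^sup>2 \<le> a * d"
    proof (cases "d = 0")
      case True
      have "b = 0"
      proof (rule ccontr)
        assume "b \<noteq> 0"
        \<comment> \<open>With \<open>d = 0\<close> the quadratic is affine in \<open>r\<close>; at
          this \<open>r\<close> it takes the value -1.\<close>
        then show False using q[of "- (a + 1) / (2 * b)"] True by (simp add: field_simps)
      qed
      then show ?thesis using True by simp
    next
      case False
      then have "d > 0" using ad by auto
      then show ?thesis using q[of "- b / d"] by (simp add: field_simps power2_eq_square)
    qed
    then show ?thesis by (simp add: a_def b_def d_def)
  qed
  show "(norm (B x))\<^sup>2 \<le> K * (B x \<bullet> x)" if K: "\<And>x. norm (B x) \<le> K * norm x" and x: "x \<in> H" for K x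
  proof (cases "B x = 0")
    case True then show ?thesis by simp
  next
    case False
    have Bx: "B x \<in> H" using B x by auto
    have "((norm (B x))\<^sup>2)\<^sup>2 \<le> (B x \<bullet> x) * (B (B x) \<bullet> B x)"
      using CS[OF x Bx] by (simp add: power2_norm_eq_inner)
    also have "B (B x) \<bullet> B x \<le> norm (B (B x)) * norm (B x)" by (rule norm_cauchy_schwarz)
    also have "\<dots> \<le> K * norm (B x) * norm (B x)" using K by (intro mult_right_mono) auto
    finally have "((norm (B x))\<^sup>2)\<^sup>2 \<le> (B x \<bullet> x) * (K * (norm (B x))\<^sup>2)"
      using pos[OF x] by (simp add: mult_left_mono power2_eq_square mult.assoc)
    then have "(norm (B x))\<^sup>2 * (norm (B x))\<^sup>2 \<le> (K * (B x \<bullet> x)) * (norm (B x))\<^sup>2"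
      by (simp add: power2_eq_square algebra_simps)
    then show ?thesis using False by (subst (asm) mult_le_cancel_right) auto
  qed
qed

text \<open>With \<open>K\<close> a bound for \<open>B\<close>, a lower bound \<open>k\<close> for
  \<open>norm (B x)\<close> on unit vectors would force the form to be at least
  \<open>k\<^sup>2 / K\<close> there.\<close>

lemma psd_inf_zero_not_bounded_below:
  fixes B :: "'a::real_inner \<Rightarrow> 'a"
  assumes "subspace H" "bounded_linear B" "B ` H \<subseteq> H"
    and "\<And>x y. B x \<bullet> y = x \<bullet> B y" and "\<And>x. x \<in> H \<Longrightarrow> 0 \<le> B x \<bullet> x"
    and inf: "\<And>\<delta>. \<delta> > 0 \<Longrightarrow> \<exists>x\<in>H. B x \<bullet> x < \<delta> * (norm x)\<^sup>2"
  shows "\<not> bounded_below_on H B"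
proof
  assume "bounded_below_on H B"
  then obtain k where k: "k > 0" "\<And>x. x \<in> H \<Longrightarrow> k * norm x \<le> norm (B x)"
    unfolding bounded_below_on_def by blast
  obtain K where K: "K > 0" "\<And>x. norm (B x) \<le> norm x * K"
    using bounded_linear.pos_bounded[OF assms(2)] by blast
  obtain x where x: "x \<in> H" "B x \<bullet> x < (k\<^sup>2 / K) * (norm x)\<^sup>2"
    using inf[of "k\<^sup>2 / K"] k K by auto
  have "k\<^sup>2 * (norm x)\<^sup>2 \<le> (norm (B x))\<^sup>2"
    using k x power_mono[of "k * norm x" "norm (B x)" 2] by (simp add: power_mult_distrib)
  also have "\<dots> \<le> K * (B x \<bullet> x)"
    using K x by (intro psd_norm_le_form[OF assms(1-5)]) (auto simp: mult.commute)
  finally show False using x K by (simp add: field_simps)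
qed

text \<open>\<open>s\<close> is the supremum of the Rayleigh quotients, so \<open>s - T\<close> has
  a nonnegative form whose infimum over unit vectors is 0; \<open>x0\<close> keeps the set of
  quotients nonempty.\<close>

lemma form_Sup_not_bounded_below:
  fixes T :: "'a::real_inner \<Rightarrow> 'a"
  assumes H: "subspace H" and T: "bounded_linear T" "T ` H \<subseteq> H"
    and sym: "\<And>x y. T x \<bullet> y = x \<bullet> T y"
    and x0: "x0 \<in> H" "x0 \<noteq> 0"
  obtains s where "\<And>x. x \<in> H \<Longrightarrow> T x \<bullet> x \<le> s * (norm x)\<^sup>2"
    and "\<not> bounded_below_on H (\<lambda>x. T x - s *\<^sub>R x)"
proof -
  interpret T: bounded_linear T by (rule T(1))
  obtain K where K: "K > 0" "\<And>x. norm (T x) \<le> norm x * K"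
    using bounded_linear.pos_bounded[OF T(1)] by blast
  define R where "R = {T x \<bullet> x / (norm x)\<^sup>2 | x. x \<in> H \<and> x \<noteq> 0}"
  have "R \<noteq> {}" using x0 unfolding R_def by auto
  have le: "T x \<bullet> x \<le> K * (norm x)\<^sup>2" for x
  proof -
    have "T x \<bullet> x \<le> norm (T x) * norm x" by (rule norm_cauchy_schwarz)
    also have "\<dots> \<le> norm x * K * norm x" using K by (intro mult_right_mono) auto
    finally show ?thesis by (simp add: power2_eq_square algebra_simps)
  qed
  have bdd: "bdd_above R"
    using le unfolding R_def by (intro bdd_aboveI[of _ K]) (auto simp: divide_le_eq)
  define s where "s = Sup R"
  have s: "T x \<bullet> x \<le> s * (norm x)\<^sup>2" if "x \<in> H" for x
  proof (cases "x = 0")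
    case False
    then have "T x \<bullet> x / (norm x)\<^sup>2 \<le> s"
      unfolding s_def using that by (intro cSup_upper bdd) (auto simp: R_def)
    then show ?thesis using False by (simp add: divide_le_eq)
  qed (simp add: T.zero)
  have "\<not> bounded_below_on H (\<lambda>x. s *\<^sub>R x - T x)"
  proof (rule psd_inf_zero_not_bounded_below[OF H])
    show "bounded_linear (\<lambda>x. s *\<^sub>R x - T x)"
      by (intro bounded_linear_sub bounded_linear_scaleR_right T(1))
    show "(\<lambda>x. s *\<^sub>R x - T x) ` H \<subseteq> H"
      using T(2) by (auto intro!: subspace_diff[OF H] subspace_scale[OF H])
    show "(s *\<^sub>R x - T x) \<bullet> y = x \<bullet> (s *\<^sub>R y - T y)" for x y
      by (simp add: inner_diff_left inner_diff_right sym)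
    show "0 \<le> (s *\<^sub>R x - T x) \<bullet> x" if "x \<in> H" for x
      using s[OF that] by (simp add: inner_diff_left power2_norm_eq_inner)
    show "\<exists>x\<in>H. (s *\<^sub>R x - T x) \<bullet> x < \<delta> * (norm x)\<^sup>2" if "\<delta> > 0" for \<delta>
    proof -
      have "s - \<delta> < Sup R" using that by (simp add: s_def)
      then obtain x where "x \<in> H" "x \<noteq> 0" "s - \<delta> < T x \<bullet> x / (norm x)\<^sup>2"
        using less_cSup_iff[OF \<open>R \<noteq> {}\<close> bdd] unfolding R_def by auto
      then show ?thesis
        by (intro bexI[of _ x]) (auto simp: inner_diff_left less_divide_eq power2_norm_eq_inner algebra_simps)
    qed
  qed
  then have "\<not> bounded_below_on H (\<lambda>x. T x - s *\<^sub>R x)"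
    by (simp add: bounded_below_on_def norm_minus_commute)
  with s show ?thesis by (rule that)
qed

section \<open>From a spectral gap to a bound for the form\<close>

text \<open>Otherwise \<open>T\<^sup>2 - \<epsilon> T\<close> has a negative form infimum \<open>-b\<close>, and
  \<open>T\<^sup>2 - \<epsilon> T + b = (T - r) (T - s)\<close> with \<open>0 < r, s < \<epsilon>\<close> is bounded below.\<close>

lemma spectral_gap_quadratic:
  fixes T :: "'a::real_inner \<Rightarrow> 'a"
  assumes H: "subspace H" and T: "bounded_linear T" "T ` H \<subseteq> H"
    and sym: "\<And>x y. T x \<bullet> y = x \<bullet> T y" and \<epsilon>: "\<epsilon> > 0"
    and gap: "\<And>\<mu>. 0 < \<mu> \<Longrightarrow> \<mu> < \<epsilon> \<Longrightarrow> bounded_below_on H (\<lambda>x. T x - \<mu> *\<^sub>R x)"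
    and x: "x \<in> H"
  shows "\<epsilon> * (T x \<bullet> x) \<le> (norm (T x))\<^sup>2"
proof (rule ccontr)
  assume neg: "\<not> ?thesis"
  interpret T: bounded_linear T by (rule T(1))
  define Q where "Q = (\<lambda>x. \<epsilon> *\<^sub>R T x - T (T x))"
  have Qx: "Q x \<bullet> x = \<epsilon> * (T x \<bullet> x) - (norm (T x))\<^sup>2" for x
    by (simp add: Q_def inner_diff_left sym power2_norm_eq_inner)
  have "x \<noteq> 0" using neg by (auto simp: T.zero)
  have TT: "bounded_linear (\<lambda>x. T (T x))" by (rule bounded_linear_compose[OF T(1) T(1)])
  obtain b where b: "\<And>x. x \<in> H \<Longrightarrow> Q x \<bullet> x \<le> b * (norm x)\<^sup>2"
    and nb: "\<not> bounded_below_on H (\<lambda>x. Q x - b *\<^sub>R x)"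
  proof (rule form_Sup_not_bounded_below[OF H, of Q x])
    show "bounded_linear Q" unfolding Q_def
      by (intro bounded_linear_sub TT bounded_linear_const_scaleR T(1))
    show "Q ` H \<subseteq> H" using T(2)
      by (auto simp: Q_def intro!: subspace_diff[OF H] subspace_scale[OF H])
    show "Q x \<bullet> y = x \<bullet> Q y" for x y by (simp add: Q_def inner_diff_left inner_diff_right sym)
  qed (use x \<open>x \<noteq> 0\<close> in auto)
  have "0 < b * (norm x)\<^sup>2" using b[OF x] neg by (simp add: Qx)
  then have bpos: "b > 0" using \<open>x \<noteq> 0\<close> by (simp add: zero_less_mult_iff)
  have factor: "bounded_below_on H (\<lambda>x. Q x - (r * (\<epsilon> - r)) *\<^sub>R x)" if r: "0 < r" "r < \<epsilon>" for r
  proof -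
    obtain k where k: "k > 0" "\<And>x. x \<in> H \<Longrightarrow> k * norm x \<le> norm (T x - r *\<^sub>R x)"
      using gap[OF r] unfolding bounded_below_on_def by blast
    obtain l where l: "l > 0" "\<And>x. x \<in> H \<Longrightarrow> l * norm x \<le> norm (T x - (\<epsilon> - r) *\<^sub>R x)"
      using gap[of "\<epsilon> - r"] r unfolding bounded_below_on_def by auto
    have "k * l * norm x \<le> norm (Q x - (r * (\<epsilon> - r)) *\<^sub>R x)" if x: "x \<in> H" for x
    proof -
      define z where "z = T x - (\<epsilon> - r) *\<^sub>R x"
      have z: "z \<in> H" using T(2) x by (auto simp: z_def intro!: subspace_diff[OF H] subspace_scale[OF H])
      have "k * l * norm x \<le> k * norm z" using l(2)[OF x] k(1) by (simp add: z_def)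
      also have "\<dots> \<le> norm (T z - r *\<^sub>R z)" by (rule k(2)[OF z])
      also have "T z - r *\<^sub>R z = - (Q x - (r * (\<epsilon> - r)) *\<^sub>R x)"
        by (simp add: z_def Q_def T.diff T.add T.scale algebra_simps)
      finally show ?thesis by (simp only: norm_minus_cancel)
    qed
    then show ?thesis using k(1) l(1) unfolding bounded_below_on_def by (intro exI[of _ "k * l"]) auto
  qed
  show False
  proof (cases "b \<le> \<epsilon>\<^sup>2 / 4")
    case True
    \<comment> \<open>\<open>\<epsilon> / 2 - w\<close> is the smaller root of
      \<open>r * (\<epsilon> - r) = b\<close>, and \<open>b > 0\<close> places it strictly between 0
      and \<open>\<epsilon>\<close>.\<close>
    define w where "w = sqrt (\<epsilon>\<^sup>2 / 4 - b)"
    have w2: "w\<^sup>2 = \<epsilon>\<^sup>2 / 4 - b" "w \<ge> 0" using True by (auto simp: w_def)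
    have "w < \<epsilon> / 2"
      using bpos \<epsilon> w2 by (auto simp: power2_eq_square intro: power2_less_imp_less)
    then have "bounded_below_on H (\<lambda>x. Q x - ((\<epsilon> / 2 - w) * (\<epsilon> - (\<epsilon> / 2 - w))) *\<^sub>R x)"
      using w2 \<epsilon> by (intro factor) auto
    also have "(\<epsilon> / 2 - w) * (\<epsilon> - (\<epsilon> / 2 - w)) = b"
      using w2 by (simp add: power2_eq_square algebra_simps)
    finally show False using nb by simp
  next
    case False
    \<comment> \<open>The roots are not real here; completing the square gives
      \<open>b - Q = (T - \<epsilon> / 2)\<^sup>2 + k\<close>, which is bounded below
      directly.\<close>
    define k where "k = b - \<epsilon>\<^sup>2 / 4"
    have "k * norm x \<le> norm (Q x - b *\<^sub>R x)" if "x \<in> H" for x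
    proof (cases "x = 0")
      case False
      have "(b *\<^sub>R x - Q x) \<bullet> x = (norm (T x - (\<epsilon> / 2) *\<^sub>R x))\<^sup>2 + k * (norm x)\<^sup>2"
        unfolding inner_diff_left Qx power2_norm_eq_inner k_def
        by (simp add: inner_diff_left inner_diff_right inner_commute power2_eq_square algebra_simps)
      then have "k * (norm x)\<^sup>2 \<le> (b *\<^sub>R x - Q x) \<bullet> x" by simp
      also have "\<dots> \<le> norm (Q x - b *\<^sub>R x) * norm x"
        by (metis norm_cauchy_schwarz norm_minus_commute)
      finally have "k * norm x * norm x \<le> norm (Q x - b *\<^sub>R x) * norm x"
        by (simp add: power2_eq_square mult.assoc)
      then show ?thesis using False by (simp add: mult_le_cancel_right)
    qed simp
    moreover have "k > 0" using False by (simp add: k_def)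
    ultimately show False using nb unfolding bounded_below_on_def by blast
  qed
qed

text \<open>Passes from \<open>T\<^sup>2 \<ge> \<epsilon> T\<close> to
  \<open>T \<ge> \<epsilon>\<close> on the range with no square root of \<open>T\<close>:
  Cauchy-Schwarz for the form of \<open>T\<close> at \<open>x\<close> and \<open>T x\<close> bounds
  \<open>norm (T x) ^ 4\<close> by the product of \<open>T x \<bullet> x\<close> and
  \<open>T (T x) \<bullet> T x\<close>.\<close>

lemma spectral_gap_on_range:
  fixes T :: "'a::real_inner \<Rightarrow> 'a"
  assumes H: "subspace H" and T: "bounded_linear T" "T ` H \<subseteq> H"
    and sym: "\<And>x y. T x \<bullet> y = x \<bullet> T y" and pos: "\<And>x. x \<in> H \<Longrightarrow> 0 \<le> T x \<bullet> x"
    and \<epsilon>: "\<epsilon> > 0"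
    and gap: "\<And>\<mu>. 0 < \<mu> \<Longrightarrow> \<mu> < \<epsilon> \<Longrightarrow> bounded_below_on H (\<lambda>x. T x - \<mu> *\<^sub>R x)"
    and x: "x \<in> H"
  shows "\<epsilon> * (norm (T x))\<^sup>2 \<le> T (T x) \<bullet> T x"
proof (cases "T x = 0")
  case False
  define n where "n = (norm (T x))\<^sup>2"
  have n: "n > 0" using False by (simp add: n_def)
  have Tx: "T x \<in> H" using T x by auto
  have "n * n \<le> (T x \<bullet> x) * (T (T x) \<bullet> T x)"
    using psd_form_Cauchy_Schwarz[OF H T sym pos x Tx]
    unfolding n_def power2_norm_eq_inner by (simp add: power2_eq_square)
  then have "\<epsilon> * (n * n) \<le> (\<epsilon> * (T x \<bullet> x)) * (T (T x) \<bullet> T x)"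
    using \<epsilon> by (simp add: mult.assoc)
  also have "\<dots> \<le> n * (T (T x) \<bullet> T x)"
    using spectral_gap_quadratic[OF H T sym \<epsilon> gap x] pos[OF Tx]
    by (intro mult_right_mono) (auto simp: n_def)
  finally have "n * (\<epsilon> * n) \<le> n * (T (T x) \<bullet> T x)" by (simp add: algebra_simps)
  then show ?thesis using n by (simp add: n_def)
qed (simp add: linear_0[OF bounded_linear.linear[OF T(1)]])

text \<open>The iterates \<open>(1 - T/K)\<^sup>n x\<close> converge geometrically to the projection of \<open>x\<close> onto the
  kernel, which is \<open>0\<close>; hence \<open>x\<close> is a limit of elements of the range of \<open>T\<close>.\<close>

lemma spectral_gap_orthogonal_kernel:
  fixes T :: "'a::real_inner \<Rightarrow> 'a"
  assumes H: "subspace H" "complete H" and T: "bounded_linear T" "T ` H \<subseteq> H"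
    and sym: "\<And>x y. T x \<bullet> y = x \<bullet> T y" and pos: "\<And>x. x \<in> H \<Longrightarrow> 0 \<le> T x \<bullet> x"
    and \<epsilon>: "\<epsilon> > 0"
    and gap: "\<And>\<mu>. 0 < \<mu> \<Longrightarrow> \<mu> < \<epsilon> \<Longrightarrow> bounded_below_on H (\<lambda>x. T x - \<mu> *\<^sub>R x)"
    and x: "x \<in> H" and perp: "\<And>y. y \<in> H \<Longrightarrow> T y = 0 \<Longrightarrow> x \<bullet> y = 0"
  shows "\<epsilon> * (norm x)\<^sup>2 \<le> T x \<bullet> x"
proof -
  interpret T: bounded_linear T by (rule T(1))
  obtain K0 where K0: "K0 > 0" "\<And>x. norm (T x) \<le> norm x * K0"
    using bounded_linear.pos_bounded[OF T(1)] by blast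
  \<comment> \<open>\<open>K\<close> bounds \<open>T\<close>, and \<open>\<epsilon> \<le> K\<close>
    keeps the argument of the square root in \<open>q\<close> nonnegative.\<close>
  define K where "K = max K0 \<epsilon>"
  have K: "K > 0" "\<epsilon> \<le> K" "\<And>x. norm (T x) \<le> K * norm x"
    using K0 unfolding K_def by (auto simp: mult.commute[of _ "norm _"] intro!: order_trans[OF K0(2)] mult_left_mono)
  define S where "S = (\<lambda>x. x - (1 / K) *\<^sub>R T x)"
  define q where "q = sqrt (1 - \<epsilon> / K)"
  have q: "0 \<le> q" "q < 1" using K \<epsilon> by (auto simp: q_def)
  have SH: "S y \<in> H" if "y \<in> H" for y
    using that T(2) by (auto simp: S_def intro!: subspace_diff[OF H(1)] subspace_scale[OF H(1)])
  have TS: "T (S y) = S (T y)" for y by (simp add: S_def T.diff T.scale)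
  \<comment> \<open>Since \<open>(norm (T z))\<^sup>2 \<le> K * (T z \<bullet> z)\<close>, one step
    lowers \<open>(norm z)\<^sup>2\<close> by at least \<open>(T z \<bullet> z) / K\<close>, which
    on the range is at least \<open>\<epsilon> * (norm z)\<^sup>2 / K\<close>.\<close>
  have contr: "norm (S (T y)) \<le> q * norm (T y)" if y: "y \<in> H" for y
  proof -
    define z where "z = T y"
    have z: "z \<in> H" using T y by (auto simp: z_def)
    have "(norm (S z))\<^sup>2 = (norm z)\<^sup>2 - 2 / K * (T z \<bullet> z) + (norm (T z))\<^sup>2 / K\<^sup>2"
      unfolding power2_norm_eq_inner S_def using K(1)
      by (simp add: inner_diff_left inner_diff_right inner_commute power2_eq_square field_simps)
    also have "\<dots> \<le> (norm z)\<^sup>2 - 2 / K * (T z \<bullet> z) + (K * (T z \<bullet> z)) / K\<^sup>2"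
      using psd_norm_le_form[OF H(1) T sym pos K(3) z] K(1)
      by (intro add_mono divide_right_mono) auto
    also have "\<dots> = (norm z)\<^sup>2 - (T z \<bullet> z) / K"
      using K(1) by (simp add: field_simps power2_eq_square)
    also have "\<dots> \<le> (norm z)\<^sup>2 - (\<epsilon> * (norm z)\<^sup>2) / K"
      using spectral_gap_on_range[OF H(1) T sym pos \<epsilon> gap y] K(1)
      by (intro diff_left_mono divide_right_mono) (auto simp: z_def)
    also have "\<dots> = (q * norm z)\<^sup>2"
      using K by (simp add: q_def power_mult_distrib algebra_simps)
    finally show ?thesis using q unfolding z_def by (auto elim!: power2_le_imp_le)
  qed
  define f where "f n = (S ^^ n) x" for n
  have f0: "f 0 = x" and fS: "f (Suc n) = S (f n)" for n by (auto simp: f_def)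
  have fH: "f n \<in> H" for n by (induction n) (auto simp: f0 fS x SH)
  have Tf: "norm (T (f n)) \<le> q ^ n * norm (T x)" for n
  proof (induction n)
    case (Suc n)
    have "norm (T (f (Suc n))) \<le> q * norm (T (f n))" using contr[OF fH] by (simp add: fS TS)
    also have "\<dots> \<le> q * (q ^ n * norm (T x))" using Suc q by (intro mult_left_mono) auto
    finally show ?case by (simp add: mult.assoc)
  qed (simp add: f0)
  have lim0: "(\<lambda>n. q ^ n * norm (T x)) \<longlonglongrightarrow> 0"
    using q by (intro tendsto_mult_left_zero LIMSEQ_realpow_zero)
  have "Cauchy f"
  proof (rule metric_CauchyI)
    have step: "norm (f (n + j) - f n) \<le> q ^ n * norm (T x) / (K * (1 - q))" for n j
    proof -
      have "norm (f (n + j) - f n) \<le> (\<Sum>i<j. q ^ (n + i) * norm (T x) / K)"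
      proof (induction j)
        case (Suc j)
        have "f (n + Suc j) - f n = (f (n + j) - f n) - (1 / K) *\<^sub>R T (f (n + j))"
          by (simp add: fS S_def)
        also have "norm \<dots> \<le> norm (f (n + j) - f n) + norm ((1 / K) *\<^sub>R T (f (n + j)))"
          by (rule norm_triangle_ineq4)
        also have "norm ((1 / K) *\<^sub>R T (f (n + j))) \<le> q ^ (n + j) * norm (T x) / K"
          using Tf[of "n + j"] K(1) by (simp add: divide_right_mono)
        finally show ?case using Suc by simp
      qed simp
      also have "\<dots> = (\<Sum>i<j. q ^ i) * (q ^ n * norm (T x) / K)"
        by (simp add: sum_distrib_left sum_divide_distrib power_add mult_ac)
      also have "\<dots> \<le> 1 / (1 - q) * (q ^ n * norm (T x) / K)"
        using q K(1) by (intro mult_right_mono) (auto simp: sum_gp_strict divide_right_mono)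
      finally show ?thesis by (simp add: mult.commute)
    qed
    fix e :: real assume "e > 0"
    have "(\<lambda>n. q ^ n * norm (T x) / (K * (1 - q))) \<longlonglongrightarrow> 0"
      by (rule tendsto_divide_zero[OF lim0])
    then obtain N where N: "\<And>n. n \<ge> N \<Longrightarrow> q ^ n * norm (T x) / (K * (1 - q)) < e / 2"
      using order_tendstoD(2)[of _ 0 sequentially "e / 2"] \<open>e > 0\<close>
      unfolding eventually_sequentially by (metis half_gt_zero)
    have near: "dist (f a) (f N) < e / 2" if "a \<ge> N" for a
      using le_less_trans[OF step[of N "a - N"] N[of N]] that by (simp add: dist_norm)
    show "\<exists>M. \<forall>a\<ge>M. \<forall>b\<ge>M. dist (f a) (f b) < e"
      using near by (meson dist_triangle_half_l)
  qed
  then obtain y where y: "y \<in> H" "f \<longlonglongrightarrow> y"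
    using H(2) fH unfolding complete_def by blast
  have "(\<lambda>n. T (f n)) \<longlonglongrightarrow> T y" by (rule T.tendsto[OF y(2)])
  moreover have "(\<lambda>n. T (f n)) \<longlonglongrightarrow> 0"
    using Tf by (intro Lim_null_comparison[OF _ lim0]) auto
  ultimately have Ty: "T y = 0" by (rule LIMSEQ_unique)
  have ran: "\<exists>u\<in>H. x - f n = T u" for n
  proof (induction n)
    case 0 then show ?case using subspace_0[OF H(1)] by (auto simp: f0 intro!: bexI[of _ 0] T.zero[symmetric])
  next
    case (Suc n)
    then obtain u where u: "u \<in> H" "x - f n = T u" by auto
    then have "x - f (Suc n) = T (u + (1 / K) *\<^sub>R f n)"
      by (simp add: fS S_def T.add T.scale algebra_simps)
    then show ?case using u fH by (blast intro: subspace_add[OF H(1)] subspace_scale[OF H(1)])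
  qed
  \<comment> \<open>By symmetry the range is orthogonal to the kernel vector \<open>y\<close>. In
    the limit \<open>x - y\<close> is orthogonal to \<open>y\<close>, and so is \<open>x\<close>,
    whence \<open>y = 0\<close>.\<close>
  have "(x - f n) \<bullet> y = 0" for n using ran[of n] Ty by (auto simp: sym)
  moreover have "(\<lambda>n. (x - f n) \<bullet> y) \<longlonglongrightarrow> (x - y) \<bullet> y" by (intro tendsto_intros y)
  ultimately have "(x - y) \<bullet> y = 0" by (simp add: LIMSEQ_const_iff)
  then have "y = 0" using perp[OF y(1) Ty] by (simp add: inner_diff_left)
  have xf: "(\<lambda>n. x - f n) \<longlonglongrightarrow> x" using tendsto_diff[OF tendsto_const y(2), of x] \<open>y = 0\<close> by simp
  show ?thesis
  proof (rule LIMSEQ_le)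
    show "(\<lambda>n. \<epsilon> * (norm (x - f n))\<^sup>2) \<longlonglongrightarrow> \<epsilon> * (norm x)\<^sup>2" by (intro tendsto_intros xf)
    show "(\<lambda>n. T (x - f n) \<bullet> (x - f n)) \<longlonglongrightarrow> T x \<bullet> x" by (intro tendsto_intros T.tendsto xf)
    show "\<exists>N. \<forall>n\<ge>N. \<epsilon> * (norm (x - f n))\<^sup>2 \<le> T (x - f n) \<bullet> (x - f n)"
      using ran spectral_gap_on_range[OF H(1) T sym pos \<epsilon> gap] by metis
  qed
qed

section \<open>From a bound for the form to a spectral gap\<close>

text \<open>\<open>T - \<mu>\<close> respects the splitting into the line through \<open>e\<close>
  and its orthogonal complement: it is \<open>- \<mu>\<close> on the line, and its form is at least
  \<open>c - \<mu>\<close> on unit vectors of the complement. The two images are orthogonal, so by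
  Pythagoras the smaller of the two bounds serves for the sum.\<close>

lemma bounded_below_off_kernel_vector:
  fixes T :: "'a::real_inner \<Rightarrow> 'a"
  assumes H: "subspace H" and T: "bounded_linear T"
    and sym: "\<And>x y. T x \<bullet> y = x \<bullet> T y"
    and e: "e \<in> H" "e \<noteq> 0" "T e = 0"
    and c: "\<And>x. x \<in> H \<Longrightarrow> x \<bullet> e = 0 \<Longrightarrow> c * (norm x)\<^sup>2 \<le> T x \<bullet> x"
    and \<mu>: "0 < \<mu>" "\<mu> < c"
  shows "bounded_below_on H (\<lambda>x. T x - \<mu> *\<^sub>R x)"
proof -
  interpret T: bounded_linear T by (rule T)
  define k where "k = min \<mu> (c - \<mu>)"
  have k: "k > 0" "k \<le> \<mu>" "k \<le> c - \<mu>" using \<mu> by (auto simp: k_def)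
  have "k * norm x \<le> norm (T x - \<mu> *\<^sub>R x)" if x: "x \<in> H" for x
  proof -
    define \<alpha> where "\<alpha> = (x \<bullet> e) / (e \<bullet> e)"
    define y where "y = x - \<alpha> *\<^sub>R e"
    have y: "y \<in> H" "y \<bullet> e = 0"
      using x e by (auto simp: y_def \<alpha>_def inner_diff_left intro!: subspace_diff[OF H] subspace_scale[OF H])
    have Tye: "T y \<bullet> e = 0" using e by (simp add: sym)
    have x_eq: "x = \<alpha> *\<^sub>R e + y" by (simp add: y_def)
    have Tx: "T x = T y" by (simp add: y_def T.diff T.scale e)
    have "k * norm y \<le> norm (T y - \<mu> *\<^sub>R y)"
    proof (cases "y = 0")
      case False
      have "k * (norm y)\<^sup>2 \<le> (c - \<mu>) * (norm y)\<^sup>2" using k by (intro mult_right_mono) auto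
      also have "\<dots> \<le> (T y - \<mu> *\<^sub>R y) \<bullet> y"
        using c[OF y] by (simp add: inner_diff_left power2_norm_eq_inner algebra_simps)
      also have "\<dots> \<le> norm (T y - \<mu> *\<^sub>R y) * norm y" by (rule norm_cauchy_schwarz)
      finally show ?thesis using False by (simp add: power2_eq_square flip: mult.assoc)
    qed simp
    then have "(k * norm y)\<^sup>2 \<le> (norm (T y - \<mu> *\<^sub>R y))\<^sup>2" using k by (intro power_mono) auto
    moreover have "(k * norm (\<alpha> *\<^sub>R e))\<^sup>2 \<le> (norm (\<mu> *\<^sub>R \<alpha> *\<^sub>R e))\<^sup>2"
      using k \<mu> by (intro power_mono) (auto simp: abs_mult mult.assoc intro!: mult_right_mono)
    moreover have "(norm (T x - \<mu> *\<^sub>R x))\<^sup>2 = (norm (T y - \<mu> *\<^sub>R y))\<^sup>2 + (norm (\<mu> *\<^sub>R \<alpha> *\<^sub>R e))\<^sup>2"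
    proof -
      have "T x - \<mu> *\<^sub>R x = (T y - \<mu> *\<^sub>R y) - \<mu> *\<^sub>R \<alpha> *\<^sub>R e"
        by (simp add: Tx) (simp add: x_eq algebra_simps)
      moreover have "(T y - \<mu> *\<^sub>R y) \<bullet> (\<mu> *\<^sub>R \<alpha> *\<^sub>R e) = 0"
        by (simp add: inner_diff_left Tye y)
      ultimately show ?thesis
        by (simp only: dot_norm_neg) simp
    qed
    moreover have "(norm x)\<^sup>2 = (norm y)\<^sup>2 + (norm (\<alpha> *\<^sub>R e))\<^sup>2"
      unfolding power2_norm_eq_inner by (subst (1 2) x_eq)
        (simp add: inner_add_left inner_add_right y inner_commute[of e y])
    ultimately have "(k * norm x)\<^sup>2 \<le> (norm (T x - \<mu> *\<^sub>R x))\<^sup>2"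
      by (simp add: power_mult_distrib algebra_simps)
    then show ?thesis by (rule power2_le_imp_le) simp
  qed
  then show ?thesis using k unfolding bounded_below_on_def by auto
qed

lemma bounded_below_above_form:
  fixes T :: "'a::real_inner \<Rightarrow> 'a"
  assumes c: "\<And>x. x \<in> H \<Longrightarrow> T x \<bullet> x \<le> c * (norm x)\<^sup>2" and \<mu>: "c < \<mu>"
  shows "bounded_below_on H (\<lambda>x. T x - \<mu> *\<^sub>R x)"
proof -
  have "(\<mu> - c) * norm x \<le> norm (T x - \<mu> *\<^sub>R x)" if x: "x \<in> H" for x
  proof (cases "x = 0")
    case False
    have "(\<mu> - c) * (norm x)\<^sup>2 \<le> (\<mu> *\<^sub>R x - T x) \<bullet> x"
      using c[OF x] by (simp add: inner_diff_left power2_norm_eq_inner algebra_simps)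
    also have "\<dots> \<le> norm (T x - \<mu> *\<^sub>R x) * norm x"
      by (metis norm_cauchy_schwarz norm_minus_commute)
    finally show ?thesis using False by (simp add: power2_eq_square flip: mult.assoc)
  qed simp
  then show ?thesis using \<mu> unfolding bounded_below_on_def by (intro exI[of _ "\<mu> - c"]) auto
qed

section \<open>The layer-cake principle\<close>

text \<open>The index type may be uncountable, whereas exchanging sum and integral in the layer-cake
  formula needs a countable index set; \<open>I\<close> is any set that carries
  \<open>f\<close>.\<close>

lemma nn_integral_count_space_infsum:
  fixes f :: "'i \<Rightarrow> real"
  assumes "f summable_on UNIV" "\<And>i. 0 \<le> f i" "\<And>i. i \<notin> I \<Longrightarrow> f i = 0"
  shows "(\<integral>\<^sup>+i. ennreal (f i) \<partial>count_space I) = ennreal (infsum f UNIV)"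
proof -
  have "f summable_on I" using assms(1) by (rule summable_on_subset) auto
  then have "Infinite_Set_Sum.abs_summable_on f I"
    using assms(2) by (simp flip: abs_summable_equivalent)
  then have "(\<integral>\<^sup>+i. ennreal (f i) \<partial>count_space I) = ennreal (infsum f I)"
    using assms(2) by (simp add: nn_integral_conv_infsetsum infsetsum_infsum)
  also have "infsum f I = infsum f UNIV" using assms(3) by (intro infsum_cong_neutral) auto
  finally show ?thesis .
qed

text \<open>By Tonelli: the index \<open>i\<close> is counted at exactly the levels in
  \<open>{l i..<r i}\<close>, an interval of length \<open>max 0 (r i - l i)\<close>.\<close>

lemma nn_integral_layer_cake:
  fixes a l r :: "'i \<Rightarrow> real"
  assumes a: "\<And>i. 0 \<le> a i" "a summable_on UNIV"
    and sum: "(\<lambda>i. a i * max 0 (r i - l i)) summable_on UNIV"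
  shows "(\<integral>\<^sup>+t. ennreal (\<Sum>\<^sub>\<infinity>i. a i * of_bool (l i \<le> t \<and> t < r i)) \<partial>lborel)
       = ennreal (\<Sum>\<^sub>\<infinity>i. a i * max 0 (r i - l i))"
proof -
  define I where "I = {i. a i \<noteq> 0}"
  have I: "countable I" using summable_countable_real[OF a(2)] by (simp add: I_def)
  have s: "(\<lambda>i. a i * of_bool (l i \<le> t \<and> t < r i)) summable_on UNIV" for t
    using a by (intro summable_on_comparison_test[OF a(2)]) auto
  have "(\<integral>\<^sup>+t. ennreal (\<Sum>\<^sub>\<infinity>i. a i * of_bool (l i \<le> t \<and> t < r i)) \<partial>lborel)
      = (\<integral>\<^sup>+t. \<integral>\<^sup>+i. ennreal (a i * of_bool (l i \<le> t \<and> t < r i)) \<partial>count_space I \<partial>lborel)"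
    using a by (subst nn_integral_count_space_infsum[OF s]) (auto simp: I_def)
  also have "\<dots> = (\<integral>\<^sup>+i. \<integral>\<^sup>+t. ennreal (a i * of_bool (l i \<le> t \<and> t < r i)) \<partial>lborel \<partial>count_space I)"
    by (intro nn_integral_count_space_nn_integral I) measurable
  also have "\<dots> = (\<integral>\<^sup>+i. ennreal (a i * max 0 (r i - l i)) \<partial>count_space I)"
  proof (intro nn_integral_cong)
    fix i
    have "(\<integral>\<^sup>+t. ennreal (a i * of_bool (l i \<le> t \<and> t < r i)) \<partial>lborel)
        = (\<integral>\<^sup>+t. ennreal (a i) * indicator {l i..<r i} t \<partial>lborel)"
      by (intro nn_integral_cong) (auto simp: indicator_def)
    also have "\<dots> = ennreal (a i) * emeasure lborel {l i..<r i}"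
      by (rule nn_integral_cmult_indicator) simp
    also have "\<dots> = ennreal (a i * max 0 (r i - l i))"
      using a(1)[of i] by (cases "l i \<le> r i") (auto simp: ennreal_mult max_def)
    finally show "(\<integral>\<^sup>+t. ennreal (a i * of_bool (l i \<le> t \<and> t < r i)) \<partial>lborel)
        = ennreal (a i * max 0 (r i - l i))" .
  qed
  also have "\<dots> = ennreal (\<Sum>\<^sub>\<infinity>i. a i * max 0 (r i - l i))"
    using a by (intro nn_integral_count_space_infsum sum) (auto simp: I_def)
  finally show ?thesis .
qed

text \<open>The form in which the co-area argument is used: an isoperimetric inequality at every
  level \<open>t\<close> integrates to an inequality between sums. The index types differ because
  one side runs over vertices and the other over ordered pairs.\<close>

lemma layer_cake_mono:
  fixes a l r :: "'i \<Rightarrow> real" and b l' r' :: "'j \<Rightarrow> real"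
  assumes a: "\<And>i. 0 \<le> a i" "a summable_on UNIV" "(\<lambda>i. a i * max 0 (r i - l i)) summable_on UNIV"
    and b: "\<And>j. 0 \<le> b j" "b summable_on UNIV" "(\<lambda>j. b j * max 0 (r' j - l' j)) summable_on UNIV"
    and le: "\<And>t. (\<Sum>\<^sub>\<infinity>i. a i * of_bool (l i \<le> t \<and> t < r i)) \<le> (\<Sum>\<^sub>\<infinity>j. b j * of_bool (l' j \<le> t \<and> t < r' j))"
  shows "(\<Sum>\<^sub>\<infinity>i. a i * max 0 (r i - l i)) \<le> (\<Sum>\<^sub>\<infinity>j. b j * max 0 (r' j - l' j))"
proof -
  have "ennreal (\<Sum>\<^sub>\<infinity>i. a i * max 0 (r i - l i)) \<le> ennreal (\<Sum>\<^sub>\<infinity>j. b j * max 0 (r' j - l' j))"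
    unfolding nn_integral_layer_cake[OF a, symmetric] nn_integral_layer_cake[OF b, symmetric]
    by (intro nn_integral_mono ennreal_leI le)
  then show ?thesis using b(1) by (subst (asm) ennreal_le_iff) (auto intro!: infsum_nonneg)
qed

lemma has_sum_UNIV_swap:
  "(f has_sum s) (UNIV :: ('a \<times> 'b) set) \<longleftrightarrow> ((\<lambda>e. f (snd e, fst e)) has_sum s) UNIV"
  using has_sum_swap[of f UNIV UNIV s] by (simp add: case_prod_unfold)

text \<open>Continuity from below, needed for the level sets at a median: a finite part of the union
  already lies in a single \<open>A n\<close>.\<close>

lemma infsum_incseq_Union_le:
  fixes f :: "'a \<Rightarrow> real" and A :: "nat \<Rightarrow> 'a set"
  assumes f: "\<And>x. 0 \<le> f x" "f summable_on UNIV" and A: "incseq A" "\<And>n. infsum f (A n) \<le> c"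
  shows "infsum f (\<Union>n. A n) \<le> c"
proof (rule infsum_le_finite_sums)
  show "f summable_on (\<Union>n. A n)" using f(2) by (rule summable_on_subset) auto
  fix F assume F: "finite F" "F \<subseteq> (\<Union>n. A n)"
  then obtain k where k: "\<And>x. x \<in> F \<Longrightarrow> x \<in> A (k x)" by (metis UN_E subsetD)
  have "F \<subseteq> A (Max (k ` F))"
  proof
    fix x assume "x \<in> F"
    then have "k x \<le> Max (k ` F)" using F(1) by simp
    then show "x \<in> A (Max (k ` F))" using incseqD[OF A(1)] k[OF \<open>x \<in> F\<close>] by blast
  qed
  then have "sum f F \<le> infsum f (A (Max (k ` F)))"
    using f F(1) by (intro finite_sum_le_infsum summable_on_subset[OF f(2)]) auto
  then show "sum f F \<le> c" using A(2) by (rule order_trans)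
qed

text \<open>Common end of both Cheeger estimates: Cauchy-Schwarz yields a quadratic inequality in
  \<open>d\<close>, and completing the square bounds \<open>d\<close> below by the smaller
  root.\<close>

lemma quadratic_Cheeger_bound:
  fixes N d h :: real
  assumes "0 \<le> N" "\<bar>h\<bar> \<le> 1" "(h * N)\<^sup>2 \<le> d * (2 * N - d)"
  shows "(1 - sqrt (1 - h\<^sup>2)) * N \<le> d"
proof -
  have h: "h\<^sup>2 \<le> 1" using assms(2) by (simp add: abs_square_le_1)
  have "(N - d)\<^sup>2 = N\<^sup>2 - d * (2 * N - d)" by (simp add: power2_eq_square algebra_simps)
  also have "\<dots> \<le> (1 - h\<^sup>2) * N\<^sup>2" using assms(3) by (simp add: power_mult_distrib algebra_simps)
  also have "\<dots> = (sqrt (1 - h\<^sup>2) * N)\<^sup>2" using h by (simp add: power_mult_distrib)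
  finally have "N - d \<le> sqrt (1 - h\<^sup>2) * N"
    by (rule power2_le_imp_le) (use assms h in auto)
  then show ?thesis by (simp add: algebra_simps)
qed

lemma has_sum_minus:
  fixes f g :: "'a \<Rightarrow> real"
  assumes "(f has_sum a) A" "(g has_sum b) A"
  shows "((\<lambda>x. f x - g x) has_sum a - b) A"
  using has_sum_add[OF assms(1) has_sum_uminusI[OF assms(2)]] by simp

section \<open>Weights and the Dirichlet form\<close>

locale nonisolated_weighted_graph = summable_weighted_graph V E m
  for V :: "'v set" and E :: "'v set set" and m :: "'v set \<Rightarrow> real" +
  assumes no_isolated: "no_isolated_vertices V E" and V_nonempty: "V \<noteq> {}"
begin

text \<open>Weights of ordered pairs: a sum of \<open>p\<close> over all pairs counts each edge twice. Both \<open>p\<close> and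
  the vertex weight vanish outside \<open>V\<close>, so all sums can range over the whole type.\<close>

definition p :: "'v \<times> 'v \<Rightarrow> real" where "p e = pair_weight E m (fst e) (snd e)"

abbreviation M :: "'v \<Rightarrow> real" where "M \<equiv> vertex_weight V E m"

lemma p_nonneg [simp]: "0 \<le> p e"
  using weight_pos by (auto simp: p_def pair_weight_def less_imp_le)

lemma p_sym: "p (v, w) = p (w, v)"
  by (simp add: p_def pair_weight_def insert_commute)

lemma p_outside: "v \<notin> V \<or> w \<notin> V \<Longrightarrow> p (v, w) = 0"
  using edge_subset by (auto simp: p_def pair_weight_def)

lemma edgeE:
  assumes "e \<in> E"
  obtains a b where "e = {a, b}" "a \<noteq> b" "a \<in> V" "b \<in> V"
  using edge_card[OF assms] edge_subset[OF assms] by (auto simp: card_2_iff)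

lemma p_summable: "p summable_on UNIV"
proof -
  \<comment> \<open>The fibre over an edge consists of its two orientations, so it contributes
    \<open>2 * m e\<close>.\<close>
  define B where "B e = {(v, w). {v, w} = e}" for e :: "'v set"
  have "((\<lambda>y. m e) has_sum 2 * m e) (B e)" if e: "e \<in> E" for e
  proof -
    obtain a b where ab: "e = {a, b}" "a \<noteq> b" using edgeE[OF e] by metis
    have "B e = {(a, b), (b, a)}" unfolding B_def ab(1) by (auto simp: doubleton_eq_iff)
    then show ?thesis using ab(2) by (intro has_sum_finiteI) auto
  qed
  then have "(\<lambda>(e, y). m e) summable_on Sigma E B"
    using weight_summable weight_pos
    by (intro summable_on_SigmaI[where g = "\<lambda>e. 2 * m e"] summable_on_cmult_right)
       (auto simp: less_imp_le)
  also have "?this \<longleftrightarrow> (\<lambda>(v, w). m {v, w}) summable_on {(v, w). {v, w} \<in> E}"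
    by (rule summable_on_reindex_bij_witness[where i = "\<lambda>(v, w). ({v, w}, (v, w))" and j = snd])
       (auto simp: B_def)
  also have "\<dots> \<longleftrightarrow> p summable_on UNIV"
    by (rule summable_on_cong_neutral) (auto simp: p_def pair_weight_def)
  finally show ?thesis .
qed

lemma p_section_summable: "(\<lambda>w. p (v, w)) summable_on UNIV"
  using summable_on_SigmaD1[of "\<lambda>v w. p (v, w)" UNIV "\<lambda>_. UNIV" v] p_summable
  by (simp add: case_prod_unfold)

lemma p_section_has_sum: "((\<lambda>w. p (v, w)) has_sum M v) UNIV"
proof -
  have "M v = (\<Sum>\<^sub>\<infinity>w. p (v, w))"
    unfolding vertex_weight_def by (rule infsum_cong_neutral) (auto simp: p_outside, simp add: p_def)
  then show ?thesis using p_section_summable by simp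
qed

lemma M_nonneg [simp]: "0 \<le> M v"
  using p_section_has_sum by (rule has_sum_nonneg) simp

lemma M_outside [simp]: "v \<notin> V \<Longrightarrow> M v = 0"
  using p_section_has_sum[of v] by (simp add: p_outside has_sum_unique[OF _ has_sum_0_simp])

lemma M_pos: "v \<in> V \<Longrightarrow> 0 < M v"
proof -
  assume v: "v \<in> V"
  then obtain e where e: "e \<in> E" "v \<in> e" using no_isolated by (auto simp: no_isolated_vertices_def)
  then obtain w where w: "e = {v, w}" by (metis edgeE doubleton_eq_iff insertE singletonD)
  have "0 < p (v, w)" using e w weight_pos by (simp add: p_def pair_weight_def)
  also have "p (v, w) \<le> M v"
    using finite_sum_le_has_sum[OF p_section_has_sum[of v], of "{w}"] by simp
  finally show ?thesis .
qed

text \<open>\<open>M\<close> is the marginal of \<open>p\<close>: vertex sums become sums over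
  pairs, where they can be compared with the energy.\<close>

lemma marginal_fst:
  assumes \<phi>: "\<And>v. 0 \<le> \<phi> v" "(\<lambda>v. M v * \<phi> v) summable_on UNIV"
  shows "((\<lambda>e. p e * \<phi> (fst e)) has_sum (\<Sum>\<^sub>\<infinity>v. M v * \<phi> v)) UNIV"
proof -
  have s: "((\<lambda>w. p (v, w) * \<phi> (fst (v, w))) has_sum M v * \<phi> v) UNIV" for v
    unfolding fst_conv by (intro has_sum_cmult_left p_section_has_sum)
  have "((\<lambda>e. p e * \<phi> (fst e)) has_sum (\<Sum>\<^sub>\<infinity>v. M v * \<phi> v)) (UNIV \<times> UNIV)"
    using \<phi> s by (intro has_sum_SigmaI[where g = "\<lambda>v. M v * \<phi> v"] has_sum_infsum
        summable_on_SigmaI[where g = "\<lambda>v. M v * \<phi> v"]) auto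
  then show ?thesis by simp
qed

lemma marginal_snd:
  assumes \<phi>: "\<And>v. 0 \<le> \<phi> v" "(\<lambda>v. M v * \<phi> v) summable_on UNIV"
  shows "((\<lambda>e. p e * \<phi> (snd e)) has_sum (\<Sum>\<^sub>\<infinity>v. M v * \<phi> v)) UNIV"
  using marginal_fst[OF assms]
  by (subst has_sum_UNIV_swap) (simp add: p_sym[of "snd _" "fst _"])

lemma M_summable: "M summable_on UNIV"
proof -
  have "(M has_sum infsum p UNIV) UNIV"
    by (rule has_sum_SigmaD[where f = p and B = "\<lambda>_. UNIV"])
       (simp_all add: p_summable p_section_has_sum)
  then show ?thesis by (rule has_sum_imp_summable)
qed

lemma set_weight_eq: "set_weight V E m S = (\<Sum>\<^sub>\<infinity>v. M v * of_bool (v \<in> S))"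
  unfolding set_weight_def by (rule infsum_cong_neutral) auto

lemma M_indicator_summable: "(\<lambda>v. M v * of_bool (Q v)) summable_on UNIV"
  by (intro summable_on_comparison_test[OF M_summable]) auto

lemma p_indicator_summable: "(\<lambda>e. p e * of_bool (Q e)) summable_on UNIV"
  by (intro summable_on_comparison_test[OF p_summable]) auto

text \<open>Disjointness leaves only one orientation of each edge from \<open>A\<close> to
  \<open>B\<close>, so no factor 2 appears although the sum runs over ordered pairs.\<close>

lemma between_weight_eq:
  assumes "A \<inter> B = {}"
  shows "between_weight E m A B = (\<Sum>\<^sub>\<infinity>e. p e * of_bool (fst e \<in> A \<and> snd e \<in> B))"
proof -
  let ?S = "{(v, w). v \<in> A \<and> w \<in> B \<and> {v, w} \<in> E}"
  have "bij_betw (\<lambda>(v, w). {v, w}) ?S {e \<in> E. \<exists>a\<in>A. \<exists>b\<in>B. e = {a, b}}"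
    unfolding bij_betw_def inj_on_def using assms by (auto simp: doubleton_eq_iff image_iff)
  then have "between_weight E m A B = (\<Sum>\<^sub>\<infinity>e\<in>?S. m {fst e, snd e})"
    unfolding between_weight_def by (subst infsum_reindex_bij_betw[symmetric]) (simp add: case_prod_unfold)+
  also have "\<dots> = (\<Sum>\<^sub>\<infinity>e. p e * of_bool (fst e \<in> A \<and> snd e \<in> B))"
    by (rule infsum_cong_neutral) (auto simp: p_def pair_weight_def)
  finally show ?thesis .
qed

lemma edge_boundary_weight_eq:
  "(\<Sum>\<^sub>\<infinity>e\<in>edge_boundary E S. m e) = (\<Sum>\<^sub>\<infinity>e. p e * of_bool (fst e \<in> S \<and> snd e \<notin> S))"
proof -
  have "edge_boundary E S = {e \<in> E. \<exists>a\<in>S. \<exists>b\<in>-S. e = {a, b}}"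
  proof -
    have "card ({a, b} \<inter> S) = 1 \<longleftrightarrow> (a \<in> S) \<noteq> (b \<in> S)" if "a \<noteq> b" for a b :: 'v
      using that by (cases "a \<in> S"; cases "b \<in> S") auto
    then have "card (e \<inter> S) = 1 \<longleftrightarrow> (\<exists>a\<in>S. \<exists>b\<in>-S. e = {a, b})" if "e \<in> E" for e
      using edgeE[OF that] by (smt (verit) ComplD ComplI doubleton_eq_iff)
    then show ?thesis unfolding edge_boundary_def by auto
  qed
  then have "(\<Sum>\<^sub>\<infinity>e\<in>edge_boundary E S. m e) = between_weight E m S (- S)"
    by (simp add: between_weight_def)
  also have "\<dots> = (\<Sum>\<^sub>\<infinity>e. p e * of_bool (fst e \<in> S \<and> snd e \<notin> S))"
    by (subst between_weight_eq) auto
  finally show ?thesis .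
qed

abbreviation W :: "'v set \<Rightarrow> real" where "W \<equiv> set_weight V E m"

definition sq_summable :: "('v \<Rightarrow> real) \<Rightarrow> bool" where
  "sq_summable f \<longleftrightarrow> (\<lambda>v. M v * (f v)\<^sup>2) summable_on UNIV"

definition N :: "('v \<Rightarrow> real) \<Rightarrow> real" where
  "N f = (\<Sum>\<^sub>\<infinity>v. M v * (f v)\<^sup>2)"

text \<open>Twice the Dirichlet form, because each edge occurs in both orientations; the quadratic
  form of the Laplacian is \<open>energy f / 2\<close>.\<close>

definition energy :: "('v \<Rightarrow> real) \<Rightarrow> real" where
  "energy f = (\<Sum>\<^sub>\<infinity>e. p e * (f (fst e) - f (snd e))\<^sup>2)"

definition cross :: "('v \<Rightarrow> real) \<Rightarrow> ('v \<Rightarrow> real) \<Rightarrow> real" where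
  "cross f g = (\<Sum>\<^sub>\<infinity>e. p e * (f (fst e) * g (snd e)))"

lemma N_nonneg [simp]: "0 \<le> N f"
  by (simp add: N_def infsum_nonneg)

lemma square_fst_has_sum: "sq_summable f \<Longrightarrow> ((\<lambda>e. p e * (f (fst e))\<^sup>2) has_sum N f) UNIV"
  using marginal_fst[of "\<lambda>v. (f v)\<^sup>2"] by (simp add: sq_summable_def N_def)

lemma square_snd_has_sum: "sq_summable f \<Longrightarrow> ((\<lambda>e. p e * (f (snd e))\<^sup>2) has_sum N f) UNIV"
  using marginal_snd[of "\<lambda>v. (f v)\<^sup>2"] by (simp add: sq_summable_def N_def)

lemma sqrt_p_mult: "sqrt (p e) * a * (sqrt (p e) * b) = p e * (a * b)"
proof -
  have "sqrt (p e) * a * (sqrt (p e) * b) = (sqrt (p e) * sqrt (p e)) * (a * b)"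
    by (simp only: mult_ac)
  then show ?thesis by simp
qed

lemma p_mult_summable:
  assumes "(\<lambda>e. p e * (x e)\<^sup>2) summable_on UNIV" "(\<lambda>e. p e * (y e)\<^sup>2) summable_on UNIV"
  shows "(\<lambda>e. p e * (x e * y e)) summable_on UNIV"
  using summable_on_mult_of_squares[of "\<lambda>e. sqrt (p e) * x e" UNIV "\<lambda>e. sqrt (p e) * y e"] assms
  by (simp add: power_mult_distrib sqrt_p_mult)

lemma p_Cauchy_Schwarz:
  assumes "(\<lambda>e. p e * (x e)\<^sup>2) summable_on UNIV" "(\<lambda>e. p e * (y e)\<^sup>2) summable_on UNIV"
  shows "(\<Sum>\<^sub>\<infinity>e. p e * (x e * y e))\<^sup>2 \<le> (\<Sum>\<^sub>\<infinity>e. p e * (x e)\<^sup>2) * (\<Sum>\<^sub>\<infinity>e. p e * (y e)\<^sup>2)"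
  using infsum_Cauchy_Schwarz[of "\<lambda>e. sqrt (p e) * x e" "\<lambda>e. sqrt (p e) * y e"] assms
  by (simp add: power_mult_distrib sqrt_p_mult)

lemma cross_has_sum:
  assumes "sq_summable f" "sq_summable g"
  shows "((\<lambda>e. p e * (f (fst e) * g (snd e))) has_sum cross f g) UNIV"
  unfolding cross_def
  using has_sum_imp_summable[OF square_fst_has_sum[OF assms(1)]]
    has_sum_imp_summable[OF square_snd_has_sum[OF assms(2)]]
  by (intro has_sum_infsum p_mult_summable)

lemma cross_commute:
  assumes "sq_summable f" "sq_summable g"
  shows "cross f g = cross g f"
proof -
  have "((\<lambda>e. p e * (g (fst e) * f (snd e))) has_sum cross f g) UNIV"
    using cross_has_sum[OF assms]
    by (subst has_sum_UNIV_swap) (simp add: p_sym[of "snd _" "fst _"] mult.commute)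
  then show ?thesis using cross_has_sum[OF assms(2,1)] has_sum_unique by blast
qed

text \<open>The third claim is the parallelogram identity; it evaluates exactly the second factor in
  the Cauchy-Schwarz step of \<open>cheeger_half_space\<close>.\<close>

lemma energy_has_sum:
  assumes "sq_summable f"
  shows "((\<lambda>e. p e * (f (fst e) - f (snd e))\<^sup>2) has_sum energy f) UNIV"
    and "energy f = 2 * N f - 2 * cross f f"
    and "((\<lambda>e. p e * (f (fst e) + f (snd e))\<^sup>2) has_sum 4 * N f - energy f) UNIV"
proof -
  note hs = has_sum_add[OF has_sum_add[OF square_fst_has_sum[OF assms] square_snd_has_sum[OF assms]]
      has_sum_cmult_right[OF cross_has_sum[OF assms assms]]]
  have minus: "((\<lambda>e. p e * (f (fst e) - f (snd e))\<^sup>2) has_sum N f + N f + (- 2) * cross f f) UNIV"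
    using hs[of "- 2"] by (simp add: power2_diff algebra_simps)
  then show e: "energy f = 2 * N f - 2 * cross f f" by (simp add: energy_def infsumI)
  then show "((\<lambda>e. p e * (f (fst e) - f (snd e))\<^sup>2) has_sum energy f) UNIV" using minus by simp
  show "((\<lambda>e. p e * (f (fst e) + f (snd e))\<^sup>2) has_sum 4 * N f - energy f) UNIV"
    using hs[of 2] by (simp add: e power2_sum algebra_simps)
qed

lemma energy_nonneg [simp]: "0 \<le> energy f"
  by (simp add: energy_def infsum_nonneg)

lemma W_nonneg [simp]: "0 \<le> W S"
  by (simp add: set_weight_def infsum_nonneg)

lemma W_pos: "S \<subseteq> V \<Longrightarrow> S \<noteq> {} \<Longrightarrow> 0 < W S"
proof -
  assume S: "S \<subseteq> V" "S \<noteq> {}"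
  then obtain v where v: "v \<in> S" by auto
  have "M summable_on S" using M_summable by (rule summable_on_subset) auto
  then have "(\<Sum>v\<in>{v}. M v) \<le> W S"
    unfolding set_weight_def using v by (intro finite_sum_le_infsum) auto
  then show ?thesis using M_pos[of v] v S by auto
qed

lemma W_Un: "A \<inter> B = {} \<Longrightarrow> W (A \<union> B) = W A + W B"
  unfolding set_weight_def
  by (intro infsum_Un_disjoint) (auto intro: summable_on_subset[OF M_summable])

lemma W_Diff: "S \<subseteq> V \<Longrightarrow> W (V - S) = W V - W S"
  using W_Un[of S "V - S"] by (simp add: Un_absorb1)

lemma W_mono: "A \<subseteq> B \<Longrightarrow> W A \<le> W B"
  unfolding set_weight_def
  by (intro infsum_mono2) (auto intro: summable_on_subset[OF M_summable])

section \<open>The Cheeger constant and functions supported on half of the weight\<close>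

abbreviation bdry :: "'v set \<Rightarrow> real" where
  "bdry S \<equiv> (\<Sum>\<^sub>\<infinity>e. p e * of_bool (fst e \<in> S \<and> snd e \<notin> S))"

lemma p_fst_has_sum: "((\<lambda>e. p e * of_bool (fst e \<in> S)) has_sum W S) UNIV"
  using marginal_fst[of "\<lambda>v. of_bool (v \<in> S)"] by (simp add: M_indicator_summable set_weight_eq)

lemma p_snd_has_sum: "((\<lambda>e. p e * of_bool (snd e \<in> S)) has_sum W S) UNIV"
  using marginal_snd[of "\<lambda>v. of_bool (v \<in> S)"] by (simp add: M_indicator_summable set_weight_eq)

lemma bdry_le: "bdry S \<le> W S"
  by (rule has_sum_mono[OF has_sum_infsum[OF p_indicator_summable] p_fst_has_sum]) auto

lemma cheeger_ratio_eq: "cheeger_ratio V E m S = bdry S / W S"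
  by (simp add: cheeger_ratio_def edge_boundary_weight_eq)

text \<open>Keeps the infimum in the Cheeger constant away from the empty set: a single vertex or
  its complement is admissible, and an edge at the vertex makes the complement nonempty.\<close>

lemma cheeger_admissible_exists: "\<exists>S. S \<subseteq> V \<and> S \<noteq> {} \<and> W S \<le> W (V - S)"
proof -
  obtain v where v: "v \<in> V" using V_nonempty by auto
  then obtain e where "e \<in> E" "v \<in> e" using no_isolated by (auto simp: no_isolated_vertices_def)
  then obtain w where w: "w \<in> V" "w \<noteq> v" by (metis edgeE insertE singletonD)
  have "V - (V - {v}) = {v}" using v by auto
  then show ?thesis
    using v w by (cases "W {v} \<le> W (V - {v})") (force intro: exI[of _ "{v}"] exI[of _ "V - {v}"])+
qed

lemma cheeger_ratio_bounds: "0 \<le> cheeger_ratio V E m S" "cheeger_ratio V E m S \<le> 1"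
  unfolding cheeger_ratio_eq using bdry_le[of S] W_nonneg[of S]
  by (auto intro!: divide_nonneg_nonneg infsum_nonneg simp: divide_le_eq_1 less_le)

abbreviation h :: real where "h \<equiv> cheeger_constant V E m"

lemma cheeger_constant_bounds: "0 \<le> h" "h \<le> 1"
proof -
  let ?R = "{cheeger_ratio V E m S | S. S \<subseteq> V \<and> S \<noteq> {} \<and> W S \<le> W (V - S)}"
  have ne: "?R \<noteq> {}" using cheeger_admissible_exists by auto
  have bdd: "bdd_below ?R" using cheeger_ratio_bounds by (auto intro!: bdd_belowI[of _ 0])
  show "0 \<le> h" unfolding cheeger_constant_def
    using ne cheeger_ratio_bounds by (intro cInf_greatest) auto
  obtain x where "x \<in> ?R" using ne by blast
  then have "h \<le> x" "x \<le> 1" unfolding cheeger_constant_def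
    using bdd cheeger_ratio_bounds by (auto intro!: cInf_lower)
  then show "h \<le> 1" by simp
qed

text \<open>Cleared of the quotient so as to cover the empty set, which does occur as a level
  set.\<close>

lemma cheeger_constant_le:
  assumes "S \<subseteq> V" "W S \<le> W (V - S)"
  shows "h * W S \<le> bdry S"
proof (cases "S = {}")
  case False
  have "h \<le> cheeger_ratio V E m S" unfolding cheeger_constant_def
    using False assms cheeger_ratio_bounds by (intro cInf_lower) (auto intro!: bdd_belowI[of _ 0])
  then show ?thesis using W_pos[OF assms(1) False] by (simp add: cheeger_ratio_eq field_simps)
qed (simp add: set_weight_def)

text \<open>For \<open>t \<ge> 0\<close> the set where \<open>g\<^sup>2\<close> exceeds
  \<open>t\<close> lies in the support of \<open>g\<close>, so it carries at most half of the weight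
  and \<open>cheeger_constant_le\<close> applies. Integrating over \<open>t\<close> turns the
  boundary weights into the positive increments of \<open>g\<^sup>2\<close>.\<close>

lemma cheeger_coarea:
  assumes g: "sq_summable g" and half: "2 * W {v \<in> V. g v \<noteq> 0} \<le> W V"
  shows "h * N g \<le> (\<Sum>\<^sub>\<infinity>e. p e * max 0 ((g (fst e))\<^sup>2 - (g (snd e))\<^sup>2))"
proof -
  have "(\<Sum>\<^sub>\<infinity>v. h * M v * max 0 ((g v)\<^sup>2 - 0)) \<le> (\<Sum>\<^sub>\<infinity>e. p e * max 0 ((g (fst e))\<^sup>2 - (g (snd e))\<^sup>2))"
  proof (rule layer_cake_mono)
    show "0 \<le> h * M v" for v using cheeger_constant_bounds by simp
    show "(\<lambda>v. h * M v) summable_on UNIV" by (intro summable_on_cmult_right M_summable)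
    show "(\<lambda>v. h * M v * max 0 ((g v)\<^sup>2 - 0)) summable_on UNIV"
      using summable_on_cmult_right[OF g[unfolded sq_summable_def], of h] by (simp add: mult.assoc)
    show "(\<lambda>e. p e * max 0 ((g (fst e))\<^sup>2 - (g (snd e))\<^sup>2)) summable_on UNIV"
      by (rule summable_on_comparison_test[OF has_sum_imp_summable[OF square_fst_has_sum[OF g]]])
         (auto intro!: mult_left_mono)
    fix t :: real
    show "(\<Sum>\<^sub>\<infinity>v. h * M v * of_bool (0 \<le> t \<and> t < (g v)\<^sup>2))
        \<le> (\<Sum>\<^sub>\<infinity>e. p e * of_bool ((g (snd e))\<^sup>2 \<le> t \<and> t < (g (fst e))\<^sup>2))"
    proof (cases "0 \<le> t")
      case True
      define S where "S = {v \<in> V. t < (g v)\<^sup>2}"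
      have "S \<subseteq> {v \<in> V. g v \<noteq> 0}" using True by (auto simp: S_def)
      from W_mono[OF this] have "2 * W S \<le> W V" using half by linarith
      then have "h * W S \<le> bdry S" by (intro cheeger_constant_le) (auto simp: S_def W_Diff)
      moreover have "h * W S = (\<Sum>\<^sub>\<infinity>v. h * M v * of_bool (0 \<le> t \<and> t < (g v)\<^sup>2))"
        unfolding set_weight_eq infsum_cmult_right'[symmetric]
        using True by (intro infsum_cong) (auto simp: S_def)
      moreover have "bdry S = (\<Sum>\<^sub>\<infinity>e. p e * of_bool ((g (snd e))\<^sup>2 \<le> t \<and> t < (g (fst e))\<^sup>2))"
        by (intro infsum_cong) (auto simp: S_def p_outside of_bool_def)
      ultimately show ?thesis by simp
    qed (auto intro!: infsum_nonneg)
  qed (auto simp: p_summable)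
  then show ?thesis by (simp add: N_def mult.assoc infsum_cmult_right')
qed

text \<open>The increments of \<open>g\<^sup>2\<close> factor as
  \<open>(g v - g w) * (g v + g w)\<close>. In Cauchy-Schwarz the second factor is kept as
  \<open>4 * N g - energy g\<close>; estimating it by \<open>4 * N g\<close> would only give the
  constant \<open>h\<^sup>2 / 2\<close>.\<close>

lemma cheeger_half_space:
  assumes g: "sq_summable g" and half: "2 * W {v \<in> V. g v \<noteq> 0} \<le> W V"
  shows "(1 - sqrt (1 - h\<^sup>2)) * N g \<le> energy g / 2"
proof (rule quadratic_Cheeger_bound)
  show "\<bar>h\<bar> \<le> 1" using cheeger_constant_bounds by simp
  let ?d = "\<lambda>e. (g (fst e))\<^sup>2 - (g (snd e))\<^sup>2"
  let ?D = "(\<Sum>\<^sub>\<infinity>e. p e * \<bar>?d e\<bar>)"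
  have s: "(\<lambda>e. p e * max 0 (?d e)) summable_on UNIV"
    by (rule summable_on_comparison_test[OF has_sum_imp_summable[OF square_fst_has_sum[OF g]]])
       (auto intro!: mult_left_mono)
  have hs: "((\<lambda>e. p e * max 0 (?d e)) has_sum (\<Sum>\<^sub>\<infinity>e. p e * max 0 (?d e))) UNIV"
    by (rule has_sum_infsum[OF s])
  \<comment> \<open>Reversing all pairs shows that the negative increments have the same sum as the
    positive ones, hence the factor 2 in the sum of absolute increments.\<close>
  have hs': "((\<lambda>e. p e * max 0 (- ?d e)) has_sum (\<Sum>\<^sub>\<infinity>e. p e * max 0 (?d e))) UNIV"
    using hs by (subst has_sum_UNIV_swap) (simp add: p_sym[of "snd _" "fst _"])
  have "p e * \<bar>?d e\<bar> = p e * max 0 (?d e) + p e * max 0 (- ?d e)" for e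
    by (auto simp: max_def abs_if algebra_simps)
  then have D: "?D = 2 * (\<Sum>\<^sub>\<infinity>e. p e * max 0 (?d e))"
    using has_sum_add[OF hs hs'] by (simp add: infsumI)
  have "?D\<^sup>2 = (\<Sum>\<^sub>\<infinity>e. p e * (\<bar>g (fst e) - g (snd e)\<bar> * \<bar>g (fst e) + g (snd e)\<bar>))\<^sup>2"
    unfolding abs_mult[symmetric] by (simp add: power2_eq_square algebra_simps)
  also have "\<dots> \<le> (\<Sum>\<^sub>\<infinity>e. p e * \<bar>g (fst e) - g (snd e)\<bar>\<^sup>2) * (\<Sum>\<^sub>\<infinity>e. p e * \<bar>g (fst e) + g (snd e)\<bar>\<^sup>2)"
    using energy_has_sum[OF g] by (intro p_Cauchy_Schwarz) (auto intro: has_sum_imp_summable)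
  also have "\<dots> = energy g * (4 * N g - energy g)"
    using infsumI[OF energy_has_sum(1)[OF g]] infsumI[OF energy_has_sum(3)[OF g]] by simp
  finally have *: "?D\<^sup>2 \<le> energy g * (4 * N g - energy g)" .
  have "2 * (h * N g) \<le> ?D" using cheeger_coarea[OF assms] D by simp
  then have "(2 * (h * N g))\<^sup>2 \<le> ?D\<^sup>2"
    using cheeger_constant_bounds by (intro power_mono) auto
  with * have "4 * (h * N g)\<^sup>2 \<le> energy g * (4 * N g - energy g)" by (simp add: power_mult_distrib)
  then show "(h * N g)\<^sup>2 \<le> energy g / 2 * (2 * N g - energy g / 2)" by (simp add: field_simps)
qed simp

section \<open>Medians and the Poincare inequality\<close>

lemma W_incseq_Union_le:
  assumes "incseq A" "\<And>n. W (A n) \<le> c"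
  shows "W (\<Union>n. A n) \<le> c"
  using assms unfolding set_weight_def by (intro infsum_incseq_Union_le M_summable) auto

text \<open>\<open>c\<close> is the infimum of the levels with at most half of the weight above
  them. Levels above \<open>c\<close> have this property and levels below do not; both claims follow
  by exhausting the strict level sets at \<open>c\<close> from inside. Strictness matters, as
  \<open>f = c\<close> may hold on most of the weight.\<close>

lemma median_exists:
  fixes f :: "'v \<Rightarrow> real"
  obtains c where "2 * W {v \<in> V. c < f v} \<le> W V" "2 * W {v \<in> V. f v < c} \<le> W V"
proof -
  define T where "T = {t. 2 * W {v \<in> V. t < f v} \<le> W V}"
  have WV: "0 < W V" using W_pos V_nonempty by blast
  have compl: "W {v \<in> V. f v \<le> t} = W V - W {v \<in> V. t < f v}" for t
  proof -
    have "{v \<in> V. f v \<le> t} = V - {v \<in> V. t < f v}" by auto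
    then show ?thesis by (simp add: W_Diff)
  qed
  have up: "s \<in> T" if "t \<in> T" "t \<le> s" for s t
  proof -
    have "W {v \<in> V. s < f v} \<le> W {v \<in> V. t < f v}" using that by (intro W_mono) auto
    then show ?thesis using that by (simp add: T_def)
  qed
  have ne: "T \<noteq> {}"
  proof
    assume "T = {}"
    then have "\<not> 2 * W {v \<in> V. real n < f v} \<le> W V" for n by (auto simp: T_def)
    then have "W {v \<in> V. f v \<le> real n} \<le> W V / 2" for n
      unfolding compl by (simp add: not_le) (metis less_imp_le mult.commute)
    then have "W (\<Union>n. {v \<in> V. f v \<le> real n}) \<le> W V / 2"
      by (intro W_incseq_Union_le) (auto simp: incseq_def)
    also have "(\<Union>n. {v \<in> V. f v \<le> real n}) = V" using real_arch_simple by auto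
    finally show False using WV by simp
  qed
  have bdd: "bdd_below T"
  proof (rule ccontr)
    assume "\<not> bdd_below T"
    then have "- real n \<in> T" for n
      using up unfolding bdd_below_def by (meson linear)
    then have "W {v \<in> V. - real n < f v} \<le> W V / 2" for n by (simp add: T_def mult.commute)
    then have "W (\<Union>n. {v \<in> V. - real n < f v}) \<le> W V / 2"
      by (intro W_incseq_Union_le) (auto simp: incseq_def)
    also have "(\<Union>n. {v \<in> V. - real n < f v}) = V"
      using reals_Archimedean2[of "- f _"] by (auto simp: minus_less_iff)
    finally show False using WV by simp
  qed
  define c where "c = Inf T"
  have mono1: "incseq (\<lambda>n. {v \<in> V. c + 1 / real (Suc n) < f v})"
    and mono2: "incseq (\<lambda>n. {v \<in> V. f v \<le> c - 1 / real (Suc n)})"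
  proof -
    have inv: "1 / real (Suc n) \<le> 1 / real (Suc k)" if "k \<le> n" for k n
      using that by (intro divide_left_mono) auto
    show "incseq (\<lambda>n. {v \<in> V. c + 1 / real (Suc n) < f v})"
      unfolding incseq_def using inv by (fastforce intro: le_less_trans)
    show "incseq (\<lambda>n. {v \<in> V. f v \<le> c - 1 / real (Suc n)})"
      unfolding incseq_def using inv by (fastforce intro: order_trans)
  qed
  have "c + 1 / real (Suc n) \<in> T" for n
  proof -
    have "Inf T < c + 1 / real (Suc n)" by (simp add: c_def)
    then obtain t where "t \<in> T" "t < c + 1 / real (Suc n)" using cInf_less_iff[OF ne bdd] by blast
    then show ?thesis using up by (meson less_imp_le)
  qed
  then have "W (\<Union>n. {v \<in> V. c + 1 / real (Suc n) < f v}) \<le> W V / 2"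
    by (intro W_incseq_Union_le mono1) (simp add: T_def mult.commute)
  also have "(\<Union>n. {v \<in> V. c + 1 / real (Suc n) < f v}) = {v \<in> V. c < f v}"
  proof (intro equalityI subsetI)
    fix v assume "v \<in> {v \<in> V. c < f v}"
    moreover from this obtain n where "inverse (real (Suc n)) < f v - c"
      using reals_Archimedean[of "f v - c"] by auto
    ultimately show "v \<in> (\<Union>n. {v \<in> V. c + 1 / real (Suc n) < f v})"
      by (intro UN_I[of n]) (auto simp: inverse_eq_divide)
  next
    fix v assume "v \<in> (\<Union>n. {v \<in> V. c + 1 / real (Suc n) < f v})"
    then obtain n where "v \<in> V" "c + 1 / real (Suc n) < f v" by auto
    moreover have "0 < 1 / real (Suc n)" by simp
    ultimately have "c < f v" by linarith
    then show "v \<in> {v \<in> V. c < f v}" using \<open>v \<in> V\<close> by simp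
  qed
  finally have 1: "2 * W {v \<in> V. c < f v} \<le> W V" by simp
  have notT: "c - 1 / real (Suc n) \<notin> T" for n
  proof
    assume "c - 1 / real (Suc n) \<in> T"
    then have "c \<le> c - 1 / real (Suc n)" unfolding c_def by (intro cInf_lower bdd)
    then show False by (simp add: field_simps)
  qed
  have "W {v \<in> V. f v \<le> c - 1 / real (Suc n)} \<le> W V / 2" for n
    using notT[of n] unfolding compl T_def mem_Collect_eq by linarith
  then have "W (\<Union>n. {v \<in> V. f v \<le> c - 1 / real (Suc n)}) \<le> W V / 2"
    by (intro W_incseq_Union_le mono2)
  also have "(\<Union>n. {v \<in> V. f v \<le> c - 1 / real (Suc n)}) = {v \<in> V. f v < c}"
  proof (intro equalityI subsetI)
    fix v assume "v \<in> {v \<in> V. f v < c}"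
    moreover from this obtain n where "inverse (real (Suc n)) < c - f v"
      using reals_Archimedean[of "c - f v"] by auto
    ultimately show "v \<in> (\<Union>n. {v \<in> V. f v \<le> c - 1 / real (Suc n)})"
      by (intro UN_I[of n]) (auto simp: inverse_eq_divide)
  next
    fix v assume "v \<in> (\<Union>n. {v \<in> V. f v \<le> c - 1 / real (Suc n)})"
    then obtain n where "v \<in> V" "f v \<le> c - 1 / real (Suc n)" by auto
    moreover have "0 < 1 / real (Suc n)" by simp
    ultimately have "f v < c" by linarith
    then show "v \<in> {v \<in> V. f v < c}" using \<open>v \<in> V\<close> by simp
  qed
  finally have "2 * W {v \<in> V. f v < c} \<le> W V" by simp
  with 1 show ?thesis by (rule that)
qed

lemma sq_summable_has_sum: "sq_summable f \<Longrightarrow> ((\<lambda>v. M v * (f v)\<^sup>2) has_sum N f) UNIV"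
  by (simp add: sq_summable_def N_def)

lemma M_mult_summable:
  assumes "sq_summable f" "sq_summable g"
  shows "(\<lambda>v. M v * (f v * g v)) summable_on UNIV"
proof -
  have "(\<lambda>v. sqrt (M v) * f v * (sqrt (M v) * g v)) summable_on UNIV"
    using assms by (intro summable_on_mult_of_squares) (simp_all add: power_mult_distrib sq_summable_def)
  also have "(\<lambda>v. sqrt (M v) * f v * (sqrt (M v) * g v)) = (\<lambda>v. (sqrt (M v) * sqrt (M v)) * (f v * g v))"
    by (simp only: mult_ac)
  finally show ?thesis by simp
qed

lemma sq_summable_mono:
  assumes "sq_summable f" "\<And>v. v \<in> V \<Longrightarrow> (g v)\<^sup>2 \<le> (f v)\<^sup>2"
  shows "sq_summable g"
  unfolding sq_summable_def
proof (rule summable_on_comparison_test[OF assms(1)[unfolded sq_summable_def]])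
  show "M v * (g v)\<^sup>2 \<le> M v * (f v)\<^sup>2" for v
    using assms(2)[of v] by (cases "v \<in> V") (auto intro: mult_left_mono)
qed simp

lemma sq_summable_const: "sq_summable (\<lambda>_. c)"
  unfolding sq_summable_def by (intro summable_on_cmult_left M_summable)

lemma W_V_has_sum: "(M has_sum W V) UNIV"
proof -
  have "W V = infsum M UNIV" unfolding set_weight_def by (rule infsum_cong_neutral) auto
  then show ?thesis using M_summable by simp
qed

lemma sq_summable_shift:
  assumes f: "sq_summable f"
  shows "sq_summable (\<lambda>v. f v - c)"
    and "N (\<lambda>v. f v - c) = N f - 2 * c * (\<Sum>\<^sub>\<infinity>v. M v * f v) + c\<^sup>2 * W V"
proof -
  have s: "(\<lambda>v. M v * f v) summable_on UNIV"
    using M_mult_summable[OF f sq_summable_const[of 1]] by simp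
  have hs: "((\<lambda>v. M v * (f v)\<^sup>2 + (- 2 * c) * (M v * f v) + c\<^sup>2 * M v) has_sum
      N f + (- 2 * c) * (\<Sum>\<^sub>\<infinity>v. M v * f v) + c\<^sup>2 * W V) UNIV"
    by (intro has_sum_add has_sum_cmult_right sq_summable_has_sum[OF f] has_sum_infsum[OF s] W_V_has_sum)
  also have "(\<lambda>v. M v * (f v)\<^sup>2 + (- 2 * c) * (M v * f v) + c\<^sup>2 * M v) = (\<lambda>v. M v * (f v - c)\<^sup>2)"
    by (auto simp: power2_eq_square algebra_simps)
  finally have "((\<lambda>v. M v * (f v - c)\<^sup>2) has_sum
      N f + (- 2 * c) * (\<Sum>\<^sub>\<infinity>v. M v * f v) + c\<^sup>2 * W V) UNIV" .
  then show "sq_summable (\<lambda>v. f v - c)"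
    and "N (\<lambda>v. f v - c) = N f - 2 * c * (\<Sum>\<^sub>\<infinity>v. M v * f v) + c\<^sup>2 * W V"
    by (auto simp: sq_summable_def N_def infsumI intro: has_sum_imp_summable)
qed

text \<open>Subtracting a median leaves the energy unchanged and, as \<open>f\<close> has mean zero,
  can only increase \<open>N\<close>. The positive and negative parts then each live on at most half
  of the weight.\<close>

lemma cheeger_Poincare:
  assumes f: "sq_summable f" and mean: "(\<Sum>\<^sub>\<infinity>v. M v * f v) = 0"
  shows "(1 - sqrt (1 - h\<^sup>2)) * N f \<le> energy f / 2"
proof -
  let ?l = "1 - sqrt (1 - h\<^sup>2)"
  have l: "0 \<le> ?l" using cheeger_constant_bounds by (simp add: abs_square_le_1 power_le_one)
  obtain c where c: "2 * W {v \<in> V. c < f v} \<le> W V" "2 * W {v \<in> V. f v < c} \<le> W V"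
    by (rule median_exists)
  define g where "g v = f v - c" for v
  define gp where "gp v = max 0 (g v)" for v
  define gn where "gn v = max 0 (- g v)" for v
  have g: "sq_summable g" unfolding g_def by (rule sq_summable_shift[OF f])
  have gp: "sq_summable gp" and gn: "sq_summable gn"
    by (rule sq_summable_mono[OF g], auto simp: gp_def gn_def max_def)+
  have "N f \<le> N g" unfolding g_def sq_summable_shift(2)[OF f] mean by simp
  also have "N g = N gp + N gn"
  proof -
    have "M v * (g v)\<^sup>2 = M v * (gp v)\<^sup>2 + M v * (gn v)\<^sup>2" for v
      by (auto simp: gp_def gn_def max_def)
    then show ?thesis
      using has_sum_add[OF sq_summable_has_sum[OF gp] sq_summable_has_sum[OF gn]]
      by (simp add: N_def infsumI)
  qed
  finally have "?l * N f \<le> ?l * N gp + ?l * N gn"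
    using l by (simp add: mult_left_mono flip: distrib_left)
  also have "\<dots> \<le> energy gp / 2 + energy gn / 2"
  proof (intro add_mono cheeger_half_space gp gn)
    have "{v \<in> V. gp v \<noteq> 0} = {v \<in> V. c < f v}" "{v \<in> V. gn v \<noteq> 0} = {v \<in> V. f v < c}"
      by (auto simp: gp_def gn_def g_def max_def)
    then show "2 * W {v \<in> V. gp v \<noteq> 0} \<le> W V" "2 * W {v \<in> V. gn v \<noteq> 0} \<le> W V" using c by auto
  qed
  also have "energy gp + energy gn \<le> energy f"
  proof (rule has_sum_mono[OF has_sum_add[OF energy_has_sum(1)[OF gp] energy_has_sum(1)[OF gn]]
        energy_has_sum(1)[OF f]])
    fix e :: "'v \<times> 'v"
    \<comment> \<open>The deficit is twice the sum of the products of \<open>gp\<close> at one end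
      with \<open>gn\<close> at the other; it is nonzero only where \<open>g\<close> changes
      sign.\<close>
    have "(gp v - gp w)\<^sup>2 + (gn v - gn w)\<^sup>2 \<le> (g v - g w)\<^sup>2" for v w
    proof -
      have "(g v - g w)\<^sup>2 - ((gp v - gp w)\<^sup>2 + (gn v - gn w)\<^sup>2) = 2 * (gp v * gn w + gp w * gn v)"
        by (cases "0 \<le> g v"; cases "0 \<le> g w")
           (auto simp: gp_def gn_def max_def power2_eq_square algebra_simps)
      moreover have "0 \<le> gp v * gn w + gp w * gn v" by (simp add: gp_def gn_def)
      ultimately show ?thesis by (metis diff_ge_0_iff_ge mult_nonneg_nonneg zero_le_numeral)
    qed
    from mult_left_mono[OF this p_nonneg]
    show "p e * (gp (fst e) - gp (snd e))\<^sup>2 + p e * (gn (fst e) - gn (snd e))\<^sup>2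
        \<le> p e * (f (fst e) - f (snd e))\<^sup>2"
      by (simp add: g_def distrib_left)
  qed
  then have "energy gp / 2 + energy gn / 2 \<le> energy f / 2" by simp
  finally show ?thesis .
qed

text \<open>The indicator of \<open>S\<close> projected orthogonally to the constants. The shift
  does not affect the energy, which sees each boundary edge in both orientations.\<close>

lemma cheeger_test_function:
  assumes S: "S \<subseteq> V"
  defines "f \<equiv> \<lambda>v. of_bool (v \<in> S) - W S / W V"
  shows "sq_summable f" "(\<Sum>\<^sub>\<infinity>v. M v * f v) = 0" "energy f / 2 = bdry S"
    "N f = W S * (1 - W S / W V)"
proof -
  let ?i = "\<lambda>v. of_bool (v \<in> S) :: real"
  have WV: "0 < W V" using W_pos V_nonempty by blast
  have i: "sq_summable ?i" by (rule sq_summable_mono[OF sq_summable_const[of 1]]) auto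
  have Mi: "((\<lambda>v. M v * ?i v) has_sum W S) UNIV"
    by (simp add: set_weight_eq M_indicator_summable)
  have Ni: "N ?i = W S" unfolding N_def set_weight_eq by (rule infsum_cong) simp
  show "sq_summable f" unfolding f_def by (rule sq_summable_shift[OF i])
  show "N f = W S * (1 - W S / W V)"
    unfolding f_def sq_summable_shift(2)[OF i] Ni infsumI[OF Mi] using WV
    by (simp add: field_simps power2_eq_square)
  have "((\<lambda>v. M v * ?i v - W S / W V * M v) has_sum W S - W S / W V * W V) UNIV"
    by (intro has_sum_minus Mi has_sum_cmult_right W_V_has_sum)
  then show "(\<Sum>\<^sub>\<infinity>v. M v * f v) = 0"
    using WV by (intro infsumI) (simp add: f_def algebra_simps)
  have b: "((\<lambda>e. p e * of_bool (fst e \<in> S \<and> snd e \<notin> S)) has_sum bdry S) UNIV"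
    by (rule has_sum_infsum[OF p_indicator_summable])
  have b': "((\<lambda>e. p e * of_bool (snd e \<in> S \<and> fst e \<notin> S)) has_sum bdry S) UNIV"
    using b by (subst has_sum_UNIV_swap) (simp add: p_sym[of "snd _" "fst _"])
  have "p e * (f (fst e) - f (snd e))\<^sup>2 =
      p e * of_bool (fst e \<in> S \<and> snd e \<notin> S) + p e * of_bool (snd e \<in> S \<and> fst e \<notin> S)" for e
    by (auto simp: f_def)
  then show "energy f / 2 = bdry S"
    using has_sum_add[OF b b'] by (simp add: energy_def infsumI)
qed

section \<open>The dual Cheeger constant\<close>

lemma dual_cheeger_ratio_eq:
  "A \<inter> B = {} \<Longrightarrow> dual_cheeger_ratio V E m A B =
    2 * (\<Sum>\<^sub>\<infinity>e. p e * of_bool (fst e \<in> A \<and> snd e \<in> B)) / (W A + W B)"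
  by (simp add: dual_cheeger_ratio_def between_weight_eq)

lemma between_le: "2 * (\<Sum>\<^sub>\<infinity>e. p e * of_bool (fst e \<in> A \<and> snd e \<in> B)) \<le> W A + W B"
proof -
  have "(\<Sum>\<^sub>\<infinity>e. p e * of_bool (fst e \<in> A \<and> snd e \<in> B)) \<le> W A"
    by (rule has_sum_mono[OF has_sum_infsum[OF p_indicator_summable] p_fst_has_sum]) auto
  moreover have "(\<Sum>\<^sub>\<infinity>e. p e * of_bool (fst e \<in> A \<and> snd e \<in> B)) \<le> W B"
    by (rule has_sum_mono[OF has_sum_infsum[OF p_indicator_summable] p_snd_has_sum]) auto
  ultimately show ?thesis by simp
qed

lemma dual_cheeger_ratio_bounds:
  assumes "A \<inter> B = {}"
  shows "0 \<le> dual_cheeger_ratio V E m A B" "dual_cheeger_ratio V E m A B \<le> 1"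
  unfolding dual_cheeger_ratio_eq[OF assms] using between_le[of A B] W_nonneg[of A] W_nonneg[of B]
  by (auto intro!: divide_nonneg_nonneg mult_nonneg_nonneg infsum_nonneg simp: divide_le_eq_1 less_le)

abbreviation hdual :: real where "hdual \<equiv> dual_cheeger_constant V E m"

abbreviation dual_ratios :: "real set" where
  "dual_ratios \<equiv> {dual_cheeger_ratio V E m A B | A B.
     A \<subseteq> V \<and> B \<subseteq> V \<and> A \<noteq> {} \<and> B \<noteq> {} \<and> A \<inter> B = {}}"

lemma dual_ratios_nonempty: "dual_ratios \<noteq> {}"
proof -
  obtain v where v: "v \<in> V" using V_nonempty by auto
  then obtain e where "e \<in> E" "v \<in> e" using no_isolated by (auto simp: no_isolated_vertices_def)
  then obtain w where w: "w \<in> V" "w \<noteq> v" by (metis edgeE insertE singletonD)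
  have "dual_cheeger_ratio V E m {v} {w} \<in> dual_ratios" using v w by blast
  then show ?thesis by blast
qed

lemma dual_ratios_bdd: "bdd_above dual_ratios"
  using dual_cheeger_ratio_bounds by (intro bdd_aboveI[of _ 1]) auto

lemma dual_cheeger_constant_bounds: "0 \<le> hdual" "hdual \<le> 1"
proof -
  obtain x where x: "x \<in> dual_ratios" using dual_ratios_nonempty by blast
  then have "x \<le> hdual" unfolding dual_cheeger_constant_def by (intro cSup_upper dual_ratios_bdd)
  moreover have "0 \<le> x" using x dual_cheeger_ratio_bounds by auto
  ultimately show "0 \<le> hdual" by simp
  show "hdual \<le> 1" unfolding dual_cheeger_constant_def
    using dual_ratios_nonempty dual_cheeger_ratio_bounds by (intro cSup_least) auto
qed

lemma dual_cheeger_constant_ge: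
  assumes "A \<subseteq> V" "B \<subseteq> V" "A \<inter> B = {}"
  shows "2 * (\<Sum>\<^sub>\<infinity>e. p e * of_bool (fst e \<in> A \<and> snd e \<in> B)) \<le> hdual * (W A + W B)"
proof (cases "A = {} \<or> B = {}")
  case True
  then have "(\<Sum>\<^sub>\<infinity>e. p e * of_bool (fst e \<in> A \<and> snd e \<in> B)) = 0" by auto
  then show ?thesis using dual_cheeger_constant_bounds by simp
next
  case False
  then have "dual_cheeger_ratio V E m A B \<le> hdual"
    unfolding dual_cheeger_constant_def using assms by (intro cSup_upper dual_ratios_bdd) auto
  moreover have "0 < W A + W B" using W_pos[of A] W_pos[of B] False assms by auto
  ultimately show ?thesis by (simp add: dual_cheeger_ratio_eq[OF assms(3)] field_simps)
qed

text \<open>The set where \<open>f\<^sup>2\<close> exceeds \<open>t\<close> is split by sign into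
  \<open>A\<close> and \<open>B\<close>. A pair of opposite signs joins them exactly at the levels
  below the smaller of its two squares, so integrating the weight between \<open>A\<close> and
  \<open>B\<close> produces the minima.\<close>

lemma dual_cheeger_coarea:
  assumes f: "sq_summable f"
  shows "(\<Sum>\<^sub>\<infinity>e. p e * (if f (fst e) * f (snd e) < 0 then min ((f (fst e))\<^sup>2) ((f (snd e))\<^sup>2) else 0))
    \<le> hdual * N f"
proof -
  let ?r = "\<lambda>e. if f (fst e) * f (snd e) < 0 then min ((f (fst e))\<^sup>2) ((f (snd e))\<^sup>2) else 0"
  have r0: "max 0 (?r e - 0) = ?r e" for e by auto
  have "(\<Sum>\<^sub>\<infinity>e. p e * max 0 (?r e - 0)) \<le> (\<Sum>\<^sub>\<infinity>v. hdual * M v * max 0 ((f v)\<^sup>2 - 0))"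
  proof (rule layer_cake_mono)
    show "(\<lambda>e. p e * max 0 (?r e - 0)) summable_on UNIV"
      by (rule summable_on_comparison_test[OF has_sum_imp_summable[OF square_fst_has_sum[OF f]]])
         (auto intro!: mult_left_mono)
    show "0 \<le> hdual * M v" for v using dual_cheeger_constant_bounds by simp
    show "(\<lambda>v. hdual * M v) summable_on UNIV" by (intro summable_on_cmult_right M_summable)
    show "(\<lambda>v. hdual * M v * max 0 ((f v)\<^sup>2 - 0)) summable_on UNIV"
      using summable_on_cmult_right[OF f[unfolded sq_summable_def], of hdual] by (simp add: mult.assoc)
    fix t :: real
    show "(\<Sum>\<^sub>\<infinity>e. p e * of_bool (0 \<le> t \<and> t < ?r e))
        \<le> (\<Sum>\<^sub>\<infinity>v. hdual * M v * of_bool (0 \<le> t \<and> t < (f v)\<^sup>2))"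
    proof (cases "0 \<le> t")
      case True
      define A B where "A = {v \<in> V. 0 < f v \<and> t < (f v)\<^sup>2}" and "B = {v \<in> V. f v < 0 \<and> t < (f v)\<^sup>2}"
      have AB: "A \<subseteq> V" "B \<subseteq> V" "A \<inter> B = {}" "B \<inter> A = {}" by (auto simp: A_def B_def)
      have "p e * of_bool (0 \<le> t \<and> t < ?r e) =
          p e * of_bool (fst e \<in> A \<and> snd e \<in> B) + p e * of_bool (fst e \<in> B \<and> snd e \<in> A)" for e
      proof (cases "fst e \<in> V \<and> snd e \<in> V")
        case True
        then show ?thesis using \<open>0 \<le> t\<close>
          by (auto simp: A_def B_def mult_less_0_iff not_less)
      next
        case False
        then have "p e = 0" using p_outside[of "fst e" "snd e"] by auto
        then show ?thesis by simp
      qed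
      then have "(\<Sum>\<^sub>\<infinity>e. p e * of_bool (0 \<le> t \<and> t < ?r e)) =
          (\<Sum>\<^sub>\<infinity>e. p e * of_bool (fst e \<in> A \<and> snd e \<in> B)) + (\<Sum>\<^sub>\<infinity>e. p e * of_bool (fst e \<in> B \<and> snd e \<in> A))"
        by (simp add: infsum_add p_indicator_summable)
      also have "\<dots> \<le> hdual * (W A + W B)"
        using dual_cheeger_constant_ge[OF AB(1-3)] dual_cheeger_constant_ge[OF AB(2,1,4)]
        by (simp add: add.commute)
      also have "W A + W B = W (A \<union> B)" using W_Un[OF AB(3)] by simp
      also have "hdual * W (A \<union> B) = (\<Sum>\<^sub>\<infinity>v. hdual * M v * of_bool (0 \<le> t \<and> t < (f v)\<^sup>2))"
        unfolding set_weight_eq infsum_cmult_right'[symmetric]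
      proof (intro infsum_cong)
        fix v
        have "v \<in> A \<union> B \<longleftrightarrow> 0 \<le> t \<and> t < (f v)\<^sup>2" if "v \<in> V"
          using that True by (cases "f v" "0 :: real" rule: linorder_cases) (auto simp: A_def B_def)
        then show "hdual * (M v * of_bool (v \<in> A \<union> B)) = hdual * M v * of_bool (0 \<le> t \<and> t < (f v)\<^sup>2)"
          by (cases "v \<in> V") auto
      qed
      finally show ?thesis .
    qed auto
  qed (auto simp: p_summable)
  then show ?thesis unfolding r0 by (simp add: N_def mult.assoc infsum_cmult_right')
qed

text \<open>On edges where \<open>f\<close> does not change sign, both factors of the Cauchy-Schwarz step are
  replaced by \<open>sqrt ((f v)\<^sup>2 + (f w)\<^sup>2)\<close>, as if the edge were split into two edges that lead to
  new vertices where \<open>f\<close> vanishes.\<close>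

lemma dual_cheeger_upper:
  assumes f: "sq_summable f"
  shows "energy f / 2 \<le> (1 + sqrt (1 - (1 - hdual)\<^sup>2)) * N f"
proof -
  define opp where "opp e \<longleftrightarrow> f (fst e) * f (snd e) < 0" for e
  define q where "q e = (f (fst e))\<^sup>2 + (f (snd e))\<^sup>2" for e
  define r where "r e = (if opp e then min ((f (fst e))\<^sup>2) ((f (snd e))\<^sup>2) else 0)" for e
  define s where "s e = (if opp e then \<bar>f (fst e) + f (snd e)\<bar> else sqrt (q e))" for e
  define d where "d e = (if opp e then \<bar>f (fst e) - f (snd e)\<bar> else sqrt (q e))" for e
  have q0: "0 \<le> q e" for e by (simp add: q_def)
  \<comment> \<open>The modified factors still satisfy \<open>s\<^sup>2 + d\<^sup>2 = 2 * q\<close>,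
    so the sum for \<open>d\<close> is determined by \<open>\<sigma>\<close> and the quadratic bound
    applies to \<open>\<sigma>\<close>.\<close>
  have s2: "(s e)\<^sup>2 = (if opp e then (f (fst e) + f (snd e))\<^sup>2 else q e)"
    and d2: "(d e)\<^sup>2 = 2 * q e - (s e)\<^sup>2" for e
    using q0 by (auto simp: s_def d_def q_def power2_sum power2_diff)
  \<comment> \<open>Across a sign change, \<open>\<bar>a\<^sup>2 - b\<^sup>2\<bar> = a\<^sup>2 +
    b\<^sup>2 - 2 * min (a\<^sup>2) (b\<^sup>2)\<close>; the minima are those bounded by
    \<open>dual_cheeger_coarea\<close>.\<close>
  have sd: "s e * d e = q e - 2 * r e" for e
  proof (cases "opp e")
    case True
    have "s e * d e = \<bar>(f (fst e))\<^sup>2 - (f (snd e))\<^sup>2\<bar>"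
      using True by (simp add: s_def d_def power2_eq_square square_diff_square_factored flip: abs_mult)
    then show ?thesis using True by (auto simp: q_def r_def min_def)
  qed (use q0 in \<open>simp add: s_def d_def r_def\<close>)
  have qs: "((\<lambda>e. p e * q e) has_sum 2 * N f) UNIV"
    using has_sum_add[OF square_fst_has_sum[OF f] square_snd_has_sum[OF f]]
    by (simp add: q_def distrib_left)
  \<comment> \<open>Without a sign change the mixed term of the square is nonnegative, so dropping
    it only decreases the square. A lower bound for \<open>\<sigma>\<close> therefore bounds
    \<open>4 * N f - energy f\<close> below, that is, the energy above.\<close>
  have s_le: "(s e)\<^sup>2 \<le> (f (fst e) + f (snd e))\<^sup>2" for e
    unfolding s2 by (auto simp: q_def opp_def power2_sum not_less)
  have ss: "(\<lambda>e. p e * (s e)\<^sup>2) summable_on UNIV"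
    by (rule summable_on_comparison_test[OF has_sum_imp_summable[OF energy_has_sum(3)[OF f]]])
       (auto intro!: mult_left_mono s_le)
  define \<sigma> where "\<sigma> = (\<Sum>\<^sub>\<infinity>e. p e * (s e)\<^sup>2) / 2"
  have ssum: "((\<lambda>e. p e * (s e)\<^sup>2) has_sum 2 * \<sigma>) UNIV" using ss by (simp add: \<sigma>_def)
  have "((\<lambda>e. 2 * (p e * q e) - p e * (s e)\<^sup>2) has_sum 2 * (2 * N f) - 2 * \<sigma>) UNIV"
    by (intro has_sum_minus has_sum_cmult_right qs ssum)
  then have dsum: "((\<lambda>e. p e * (d e)\<^sup>2) has_sum 4 * N f - 2 * \<sigma>) UNIV"
    by (simp add: d2 algebra_simps)
  have rsum: "(\<lambda>e. p e * r e) summable_on UNIV"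
    by (rule summable_on_comparison_test[OF has_sum_imp_summable[OF square_fst_has_sum[OF f]]])
       (auto intro!: mult_left_mono simp: r_def)
  have "((\<lambda>e. p e * q e - 2 * (p e * r e)) has_sum 2 * N f - 2 * (\<Sum>\<^sub>\<infinity>e. p e * r e)) UNIV"
    by (intro has_sum_minus has_sum_cmult_right qs has_sum_infsum rsum)
  then have "(\<Sum>\<^sub>\<infinity>e. p e * (s e * d e)) = 2 * N f - 2 * (\<Sum>\<^sub>\<infinity>e. p e * r e)"
    by (intro infsumI) (simp add: sd right_diff_distrib mult.left_commute[of _ 2])
  also have "\<dots> \<ge> 2 * ((1 - hdual) * N f)"
    using dual_cheeger_coarea[OF f] by (simp add: r_def opp_def algebra_simps)
  finally have "(2 * ((1 - hdual) * N f))\<^sup>2 \<le> (\<Sum>\<^sub>\<infinity>e. p e * (s e * d e))\<^sup>2"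
    using dual_cheeger_constant_bounds by (intro power_mono) auto
  also have "\<dots> \<le> (\<Sum>\<^sub>\<infinity>e. p e * (s e)\<^sup>2) * (\<Sum>\<^sub>\<infinity>e. p e * (d e)\<^sup>2)"
    using ss dsum by (intro p_Cauchy_Schwarz) (auto intro: has_sum_imp_summable)
  also have "\<dots> = 2 * \<sigma> * (4 * N f - 2 * \<sigma>)" using infsumI[OF ssum] infsumI[OF dsum] by simp
  finally have "((1 - hdual) * N f)\<^sup>2 \<le> \<sigma> * (2 * N f - \<sigma>)"
    unfolding power_mult_distrib[of 2] by (simp add: right_diff_distrib)
  then have "(1 - sqrt (1 - (1 - hdual)\<^sup>2)) * N f \<le> \<sigma>"
    using dual_cheeger_constant_bounds by (intro quadratic_Cheeger_bound) auto
  moreover have "2 * \<sigma> \<le> 4 * N f - energy f"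
    by (rule has_sum_mono[OF ssum energy_has_sum(3)[OF f]]) (auto intro!: mult_left_mono s_le)
  ultimately show ?thesis by (simp add: algebra_simps)
qed

text \<open>Across an edge between \<open>A\<close> and \<open>B\<close> the function jumps by 2,
  and both orientations count; the contributions of all other edges are dropped.\<close>

lemma dual_test_function:
  assumes AB: "A \<inter> B = {}"
  defines "f \<equiv> \<lambda>v. of_bool (v \<in> A) - of_bool (v \<in> B)"
  shows "sq_summable f" "N f = W A + W B"
    "4 * (\<Sum>\<^sub>\<infinity>e. p e * of_bool (fst e \<in> A \<and> snd e \<in> B)) \<le> energy f / 2"
proof -
  show f: "sq_summable f"
    by (rule sq_summable_mono[OF sq_summable_const[of 1]]) (auto simp: f_def of_bool_def)
  have "M v * (f v)\<^sup>2 = M v * of_bool (v \<in> A \<union> B)" for v using AB by (auto simp: f_def)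
  then have "N f = W (A \<union> B)" unfolding N_def set_weight_eq by (intro infsum_cong)
  then show "N f = W A + W B" by (simp add: W_Un[OF AB])
  have b: "((\<lambda>e. p e * of_bool (fst e \<in> A \<and> snd e \<in> B)) has_sum
      (\<Sum>\<^sub>\<infinity>e. p e * of_bool (fst e \<in> A \<and> snd e \<in> B))) UNIV" (is "(_ has_sum ?b) _")
    by (rule has_sum_infsum[OF p_indicator_summable])
  have b': "((\<lambda>e. p e * of_bool (snd e \<in> A \<and> fst e \<in> B)) has_sum ?b) UNIV"
    using b by (subst has_sum_UNIV_swap) (simp add: p_sym[of "snd _" "fst _"])
  have "4 * ?b + 4 * ?b \<le> energy f"
    by (rule has_sum_mono[OF has_sum_add[OF b[THEN has_sum_cmult_right] b'[THEN has_sum_cmult_right]]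
          energy_has_sum(1)[OF f]])
       (use AB in \<open>auto simp: f_def\<close>)
  then show "4 * ?b \<le> energy f / 2" by simp
qed

section \<open>The Laplacian and its spectrum\<close>

abbreviation L2G :: "('v \<Rightarrow> real) set" where "L2G \<equiv> L2 V E m"
abbreviation ip :: "('v \<Rightarrow> real) \<Rightarrow> ('v \<Rightarrow> real) \<Rightarrow> real" where "ip \<equiv> L2_inner V E m"
abbreviation lap :: "('v \<Rightarrow> real) \<Rightarrow> 'v \<Rightarrow> real" where "lap \<equiv> laplacian V E m"

lemma L2_iff: "f \<in> L2G \<longleftrightarrow> (\<forall>v. v \<notin> V \<longrightarrow> f v = 0) \<and> sq_summable f"
proof -
  have "(\<lambda>v. M v * (f v)\<^sup>2) summable_on V \<longleftrightarrow> sq_summable f"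
    unfolding sq_summable_def by (rule summable_on_cong_neutral) auto
  then show ?thesis by (simp add: L2_def)
qed

lemma L2_inner_eq: "ip f g = (\<Sum>\<^sub>\<infinity>v. M v * (f v * g v))"
  unfolding L2_inner_def by (rule infsum_cong_neutral) auto

lemma L2_inner_self: "ip f f = N f"
  by (simp add: L2_inner_eq N_def power2_eq_square)

lemma sq_summable_lincomb:
  assumes "sq_summable f" "sq_summable g"
  shows "sq_summable (\<lambda>v. a * f v + b * g v)"
proof -
  have "(\<lambda>v. (a * (sqrt (M v) * f v) + b * (sqrt (M v) * g v))\<^sup>2) summable_on UNIV"
    using assms by (intro summable_on_square_add summable_on_square_cmult)
      (simp_all add: power_mult_distrib sq_summable_def)
  also have "(\<lambda>v. (a * (sqrt (M v) * f v) + b * (sqrt (M v) * g v))\<^sup>2) =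
      (\<lambda>v. (sqrt (M v))\<^sup>2 * (a * f v + b * g v)\<^sup>2)"
    unfolding power_mult_distrib[symmetric] by (simp add: algebra_simps)
  finally show ?thesis by (simp add: sq_summable_def)
qed

lemma L2_lincomb:
  assumes "f \<in> L2G" "g \<in> L2G"
  shows "(\<lambda>v. a * f v + b * g v) \<in> L2G"
  using assms sq_summable_lincomb by (auto simp: L2_iff)

text \<open>The transition operator of the random walk on the weighted graph; on \<open>V\<close>
  the Laplacian is the identity minus this operator.\<close>

definition avg :: "('v \<Rightarrow> real) \<Rightarrow> 'v \<Rightarrow> real" where
  "avg f v = (\<Sum>\<^sub>\<infinity>w. p (v, w) * f w) / M v"

lemma avg_summable:
  assumes f: "sq_summable f"
  shows "(\<lambda>w. p (v, w) * (f w)\<^sup>2) summable_on UNIV" "(\<lambda>w. p (v, w) * f w) summable_on UNIV"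
proof -
  show s: "(\<lambda>w. p (v, w) * (f w)\<^sup>2) summable_on UNIV"
    using summable_on_SigmaD1[of "\<lambda>v w. p (v, w) * (f w)\<^sup>2" UNIV "\<lambda>_. UNIV" v]
      has_sum_imp_summable[OF square_snd_has_sum[OF f]]
    by (simp add: case_prod_unfold)
  have "(\<lambda>w. sqrt (p (v, w)) * (sqrt (p (v, w)) * f w)) summable_on UNIV"
    using s p_section_summable
    by (intro summable_on_mult_of_squares) (simp_all add: power_mult_distrib)
  then show "(\<lambda>w. p (v, w) * f w) summable_on UNIV" by (simp flip: mult.assoc)
qed

lemma laplacian_eq: "v \<in> V \<Longrightarrow> lap f v = f v - avg f v"
proof -
  assume v: "v \<in> V"
  have "(\<Sum>\<^sub>\<infinity>w\<in>V. pair_weight E m v w / M v * f w) = (\<Sum>\<^sub>\<infinity>w. inverse (M v) * (p (v, w) * f w))"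
    by (rule infsum_cong_neutral) (auto simp: p_outside, simp add: p_def field_simps)
  then show ?thesis using v unfolding infsum_cmult_right'
    by (simp add: laplacian_def avg_def divide_inverse mult.commute)
qed

lemma laplacian_outside: "v \<notin> V \<Longrightarrow> lap f v = 0"
  by (simp add: laplacian_def)

lemma avg_lincomb:
  assumes "sq_summable f" "sq_summable g"
  shows "avg (\<lambda>v. a * f v + b * g v) v = a * avg f v + b * avg g v"
proof -
  have "((\<lambda>w. a * (p (v, w) * f w) + b * (p (v, w) * g w)) has_sum
      a * (\<Sum>\<^sub>\<infinity>w. p (v, w) * f w) + b * (\<Sum>\<^sub>\<infinity>w. p (v, w) * g w)) UNIV"
    using assms by (intro has_sum_add has_sum_cmult_right has_sum_infsum avg_summable)
  then have "(\<Sum>\<^sub>\<infinity>w. p (v, w) * (a * f w + b * g w)) =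
      a * (\<Sum>\<^sub>\<infinity>w. p (v, w) * f w) + b * (\<Sum>\<^sub>\<infinity>w. p (v, w) * g w)"
    by (intro infsumI) (simp add: algebra_simps)
  then show ?thesis by (simp add: avg_def add_divide_distrib)
qed

lemma laplacian_lincomb:
  assumes "f \<in> L2G" "g \<in> L2G"
  shows "lap (\<lambda>v. a * f v + b * g v) = (\<lambda>v. a * lap f v + b * lap g v)"
proof
  fix v show "lap (\<lambda>v. a * f v + b * g v) v = a * lap f v + b * lap g v"
    using assms avg_lincomb[of f g a b v]
    by (cases "v \<in> V") (auto simp: laplacian_eq laplacian_outside L2_iff algebra_simps)
qed

text \<open>Jensen at each vertex bounds \<open>M v * (avg f v)\<^sup>2\<close> by the sum of
  \<open>p (v, w) * (f w)\<^sup>2\<close> over \<open>w\<close>; summing over \<open>v\<close> gives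
  back \<open>N f\<close> by the symmetry of \<open>p\<close>.\<close>

lemma sq_summable_avg:
  assumes f: "sq_summable f"
  shows "sq_summable (avg f)" "N (avg f) \<le> N f"
proof -
  define r where "r v = (\<Sum>\<^sub>\<infinity>w. p (v, w) * (f w)\<^sup>2)" for v
  have r: "(r has_sum N f) UNIV"
    by (rule has_sum_SigmaD[where f = "\<lambda>e. p e * (f (snd e))\<^sup>2" and B = "\<lambda>_. UNIV"])
       (simp_all add: square_snd_has_sum[OF f] r_def avg_summable[OF f])
  have le: "M v * (avg f v)\<^sup>2 \<le> r v" for v
  proof (cases "v \<in> V")
    case True
    have "(\<Sum>\<^sub>\<infinity>w. sqrt (p (v, w)) * (sqrt (p (v, w)) * f w))\<^sup>2
        \<le> (\<Sum>\<^sub>\<infinity>w. (sqrt (p (v, w)))\<^sup>2) * (\<Sum>\<^sub>\<infinity>w. (sqrt (p (v, w)) * f w)\<^sup>2)"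
      using p_section_summable avg_summable[OF f]
      by (intro infsum_Cauchy_Schwarz) (simp_all add: power_mult_distrib)
    then have "(\<Sum>\<^sub>\<infinity>w. p (v, w) * f w)\<^sup>2 \<le> M v * r v"
      by (simp add: power_mult_distrib r_def infsumI[OF p_section_has_sum] flip: mult.assoc)
    then show ?thesis
      using M_pos[OF True] by (simp add: avg_def power_divide field_simps power2_eq_square)
  next
    case False
    then show ?thesis by (simp add: r_def infsum_nonneg)
  qed
  show s: "sq_summable (avg f)" unfolding sq_summable_def
    using le by (intro summable_on_comparison_test[OF has_sum_imp_summable[OF r]]) auto
  show "N (avg f) \<le> N f" by (rule has_sum_mono[OF sq_summable_has_sum[OF s] r le])
qed

lemma avg_inner:
  assumes f: "sq_summable f" and g: "sq_summable g"
  shows "(\<Sum>\<^sub>\<infinity>v. M v * (avg f v * g v)) = cross g f"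
proof -
  have "((\<lambda>v. g v * (\<Sum>\<^sub>\<infinity>w. p (v, w) * f w)) has_sum cross g f) UNIV"
  proof (rule has_sum_SigmaD[where f = "\<lambda>e. p e * (g (fst e) * f (snd e))" and B = "\<lambda>_. UNIV"])
    fix v
    have "((\<lambda>w. g v * (p (v, w) * f w)) has_sum g v * (\<Sum>\<^sub>\<infinity>w. p (v, w) * f w)) UNIV"
      by (intro has_sum_cmult_right has_sum_infsum avg_summable f)
    then show "((\<lambda>w. p (v, w) * (g (fst (v, w)) * f (snd (v, w)))) has_sum
        g v * (\<Sum>\<^sub>\<infinity>w. p (v, w) * f w)) UNIV" by (simp add: mult_ac)
  qed (simp add: cross_has_sum[OF g f])
  moreover have "M v * (avg f v * g v) = g v * (\<Sum>\<^sub>\<infinity>w. p (v, w) * f w)" for v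
    using M_pos[of v] by (cases "v \<in> V") (auto simp: avg_def p_outside)
  ultimately show ?thesis using infsumI by (simp only:)
qed

lemma laplacian_L2:
  assumes f: "f \<in> L2G"
  shows "lap f \<in> L2G" "N (lap f) \<le> 4 * N f"
proof -
  have sf: "sq_summable f" using f by (simp add: L2_iff)
  note sa = sq_summable_avg[OF sf]
  have le: "M v * (lap f v)\<^sup>2 \<le> 2 * (M v * (f v)\<^sup>2) + 2 * (M v * (avg f v)\<^sup>2)" for v
  proof (cases "v \<in> V")
    case True
    have "(f v - avg f v)\<^sup>2 \<le> 2 * (f v)\<^sup>2 + 2 * (avg f v)\<^sup>2"
      using zero_le_power2[of "f v + avg f v"] by (simp add: power2_sum power2_diff)
    from mult_left_mono[OF this, of "M v"] show ?thesis
      by (simp add: laplacian_eq[OF True] distrib_left mult.left_commute)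
  qed (simp add: laplacian_outside)
  have hs: "((\<lambda>v. 2 * (M v * (f v)\<^sup>2) + 2 * (M v * (avg f v)\<^sup>2)) has_sum 2 * N f + 2 * N (avg f)) UNIV"
    by (intro has_sum_add has_sum_cmult_right sq_summable_has_sum sf sa)
  have s: "sq_summable (lap f)" unfolding sq_summable_def
    by (rule summable_on_comparison_test[OF has_sum_imp_summable[OF hs] le]) simp
  then show "lap f \<in> L2G" by (simp add: L2_iff laplacian_outside)
  have "N (lap f) \<le> 2 * N f + 2 * N (avg f)"
    by (rule has_sum_mono[OF sq_summable_has_sum[OF s] hs le])
  then show "N (lap f) \<le> 4 * N f" using sa(2) by simp
qed

lemma laplacian_inner:
  assumes f: "f \<in> L2G" and g: "g \<in> L2G"
  shows "ip (lap f) g = ip f g - cross g f"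
proof -
  have s: "sq_summable f" "sq_summable g" using f g by (auto simp: L2_iff)
  have "((\<lambda>v. M v * (f v * g v) - M v * (avg f v * g v)) has_sum ip f g - cross g f) UNIV"
    unfolding L2_inner_eq avg_inner[OF s, symmetric]
    by (intro has_sum_minus has_sum_infsum M_mult_summable s sq_summable_avg)
  moreover have "M v * (f v * g v) - M v * (avg f v * g v) = M v * (lap f v * g v)" for v
    by (cases "v \<in> V") (auto simp: laplacian_eq algebra_simps)
  ultimately show ?thesis by (simp add: L2_inner_eq infsumI)
qed

lemma laplacian_form: "f \<in> L2G \<Longrightarrow> ip (lap f) f = energy f / 2"
  by (simp add: laplacian_inner L2_inner_self energy_has_sum(2) L2_iff)

section \<open>Transfer of the Laplacian to \<open>ell2\<close>\<close>

definition to_ell2 :: "('v \<Rightarrow> real) \<Rightarrow> 'v ell2" where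
  "to_ell2 f = Abs_ell2 (\<lambda>v. sqrt (M v) * f v)"

text \<open>Outside \<open>V\<close> the divisor is 0 and the quotient therefore 0, so the result
  lies in \<open>L2G\<close> for every \<open>x\<close>, not only for \<open>x\<close> in
  \<open>H\<close>.\<close>

definition of_ell2 :: "'v ell2 \<Rightarrow> 'v \<Rightarrow> real" where
  "of_ell2 x v = ell2_nth x v / sqrt (M v)"

definition H :: "'v ell2 set" where
  "H = {x. \<forall>v. v \<notin> V \<longrightarrow> ell2_nth x v = 0}"

text \<open>Through \<open>of_ell2\<close> the operator is total: it annihilates vectors supported
  outside \<open>V\<close> and maps everything into \<open>H\<close>. It is thus bounded and
  symmetric on the whole type, as the abstract lemmas require.\<close>

definition T :: "'v ell2 \<Rightarrow> 'v ell2" where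
  "T x = to_ell2 (lap (of_ell2 x))"

lemma nth_to_ell2: "sq_summable f \<Longrightarrow> ell2_nth (to_ell2 f) v = sqrt (M v) * f v"
  by (simp add: to_ell2_def Abs_ell2_inverse power_mult_distrib sq_summable_def)

lemma of_ell2_L2: "of_ell2 x \<in> L2G"
proof -
  have "sq_summable (of_ell2 x)" unfolding sq_summable_def
  proof (rule summable_on_comparison_test[OF ell2_nth_square_summable[of x]])
    show "M v * (of_ell2 x v)\<^sup>2 \<le> (ell2_nth x v)\<^sup>2" for v
      using M_pos[of v] by (cases "v \<in> V") (auto simp: of_ell2_def power_divide)
  qed simp
  then show ?thesis by (simp add: L2_iff of_ell2_def)
qed

lemma to_ell2_in_H: "f \<in> L2G \<Longrightarrow> to_ell2 f \<in> H"
  by (auto simp: H_def nth_to_ell2 L2_iff)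

lemma of_ell2_to_ell2: "f \<in> L2G \<Longrightarrow> of_ell2 (to_ell2 f) = f"
proof
  fix v assume "f \<in> L2G"
  then show "of_ell2 (to_ell2 f) v = f v"
    using M_pos[of v] by (cases "v \<in> V") (auto simp: of_ell2_def nth_to_ell2 L2_iff)
qed

lemma to_ell2_of_ell2: "x \<in> H \<Longrightarrow> to_ell2 (of_ell2 x) = x"
proof (rule ell2_eqI)
  fix v assume "x \<in> H"
  then show "ell2_nth (to_ell2 (of_ell2 x)) v = ell2_nth x v"
    using M_pos[of v] of_ell2_L2[of x]
    by (cases "v \<in> V") (auto simp: nth_to_ell2 L2_iff H_def, simp add: of_ell2_def)
qed

lemma to_ell2_lincomb:
  assumes "f \<in> L2G" "g \<in> L2G"
  shows "to_ell2 (\<lambda>v. a * f v + b * g v) = a *\<^sub>R to_ell2 f + b *\<^sub>R to_ell2 g"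
proof -
  have s: "sq_summable f" "sq_summable g" "sq_summable (\<lambda>v. a * f v + b * g v)"
    using assms sq_summable_lincomb by (auto simp: L2_iff)
  then show ?thesis by (intro ell2_eqI) (simp add: nth_to_ell2 algebra_simps)
qed

lemma of_ell2_lincomb: "of_ell2 (a *\<^sub>R x + b *\<^sub>R y) = (\<lambda>v. a * of_ell2 x v + b * of_ell2 y v)"
  by (auto simp: of_ell2_def add_divide_distrib)

lemma inner_to_ell2:
  assumes "f \<in> L2G"
  shows "to_ell2 f \<bullet> y = ip f (of_ell2 y)"
  unfolding inner_ell2.rep_eq L2_inner_eq
proof (rule infsum_cong)
  fix v
  have "sqrt (M v) * sqrt (M v) = M v" by simp
  then show "ell2_nth (to_ell2 f) v * ell2_nth y v = M v * (f v * of_ell2 y v)"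
    using M_pos[of v] assms
    by (cases "v \<in> V") (auto simp: nth_to_ell2 L2_iff of_ell2_def field_simps)
qed

lemma norm_to_ell2: "f \<in> L2G \<Longrightarrow> norm (to_ell2 f) = L2_norm V E m f"
  by (simp add: norm_eq_sqrt_inner inner_to_ell2 of_ell2_to_ell2 L2_norm_def)

lemma norm_to_ell2_square: "f \<in> L2G \<Longrightarrow> (norm (to_ell2 f))\<^sup>2 = N f"
  by (simp add: power2_norm_eq_inner inner_to_ell2 of_ell2_to_ell2 L2_inner_self)

lemma subspace_H: "subspace H"
  by (auto simp: H_def subspace_def)

lemma complete_H: "complete H"
  unfolding H_def by (rule complete_ell2_supported)

lemma T_in_H: "T x \<in> H"
  by (simp add: T_def to_ell2_in_H laplacian_L2 of_ell2_L2)

lemma T_image: "T ` H \<subseteq> H"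
  using T_in_H by blast

lemma T_lincomb: "T (a *\<^sub>R x + b *\<^sub>R y) = a *\<^sub>R T x + b *\<^sub>R T y"
  unfolding T_def of_ell2_lincomb
  by (simp add: laplacian_lincomb to_ell2_lincomb laplacian_L2 of_ell2_L2)

lemma norm_of_ell2_le: "N (of_ell2 x) \<le> (norm x)\<^sup>2"
proof -
  have "N (of_ell2 x) = to_ell2 (of_ell2 x) \<bullet> x"
    by (simp add: inner_to_ell2 of_ell2_L2 L2_inner_self)
  also have "\<dots> \<le> norm (to_ell2 (of_ell2 x)) * norm x" by (rule norm_cauchy_schwarz)
  also have "norm (to_ell2 (of_ell2 x)) = sqrt (N (of_ell2 x))"
    by (simp add: norm_to_ell2 of_ell2_L2 L2_norm_def L2_inner_self)
  finally have "sqrt (N (of_ell2 x)) * sqrt (N (of_ell2 x)) \<le> sqrt (N (of_ell2 x)) * norm x" by simp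
  then have "sqrt (N (of_ell2 x)) \<le> norm x"
    by (cases "N (of_ell2 x) = 0") (simp, subst (asm) mult_le_cancel_left, auto simp: less_le)
  then show ?thesis by (simp add: real_sqrt_le_iff' sqrt_le_D)
qed

lemma bounded_linear_T: "bounded_linear T"
proof (rule bounded_linear_intro[where K = 2])
  show "T (x + y) = T x + T y" for x y using T_lincomb[of 1 x 1 y] by simp
  show "T (r *\<^sub>R x) = r *\<^sub>R T x" for r x using T_lincomb[of r x 0 0] by simp
  show "norm (T x) \<le> norm x * 2" for x
  proof (rule power2_le_imp_le)
    have "(norm (T x))\<^sup>2 \<le> 4 * N (of_ell2 x)"
      by (simp add: T_def norm_to_ell2_square laplacian_L2 of_ell2_L2)
    also have "\<dots> \<le> 4 * (norm x)\<^sup>2" using norm_of_ell2_le by simp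
    finally show "(norm (T x))\<^sup>2 \<le> (norm x * 2)\<^sup>2" by (simp add: power_mult_distrib)
  qed simp
qed

lemma T_sym: "T x \<bullet> y = x \<bullet> T y"
proof -
  have "T x \<bullet> y = ip (of_ell2 x) (of_ell2 y) - cross (of_ell2 y) (of_ell2 x)" for x y
    by (simp add: T_def inner_to_ell2 laplacian_L2 of_ell2_L2 laplacian_inner)
  moreover have "cross (of_ell2 y) (of_ell2 x) = cross (of_ell2 x) (of_ell2 y)"
    using of_ell2_L2 by (intro cross_commute) (auto simp: L2_iff)
  moreover have "ip f g = ip g f" for f g by (simp add: L2_inner_eq mult.commute)
  ultimately show ?thesis by (metis inner_commute)
qed

lemma T_form: "T x \<bullet> x = energy (of_ell2 x) / 2"
  by (simp add: T_def inner_to_ell2 laplacian_L2 of_ell2_L2 laplacian_form)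

lemma norm_H: "x \<in> H \<Longrightarrow> (norm x)\<^sup>2 = N (of_ell2 x)"
  using norm_to_ell2_square[OF of_ell2_L2[of x]] by (simp add: to_ell2_of_ell2)

section \<open>Spectrum and approximate eigenvalues\<close>

lemma to_ell2_laplacian_minus:
  "f \<in> L2G \<Longrightarrow> to_ell2 (\<lambda>v. lap f v - \<mu> * f v) = T (to_ell2 f) - \<mu> *\<^sub>R to_ell2 f"
  using to_ell2_lincomb[of "lap f" f 1 "- \<mu>"] by (simp add: laplacian_L2 T_def of_ell2_to_ell2)

lemma laplacian_minus_L2: "f \<in> L2G \<Longrightarrow> (\<lambda>v. lap f v - \<mu> * f v) \<in> L2G"
  using L2_lincomb[of "lap f" f 1 "- \<mu>"] by (simp add: laplacian_L2)

lemma to_ell2_inject: "f \<in> L2G \<Longrightarrow> g \<in> L2G \<Longrightarrow> to_ell2 f = to_ell2 g \<Longrightarrow> f = g"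
  by (metis of_ell2_to_ell2)

text \<open>A bounded inverse bounds \<open>x\<close> by its image under \<open>T - \<mu>\<close>.
  Conversely, surjectivity provides preimages chosen one by one; injectivity makes the choice linear
  and a two-sided inverse, and the lower bound makes it bounded.\<close>

lemma spectrum_iff:
  "\<mu> \<in> L2_spectrum V E m lap \<longleftrightarrow> \<not> bounded_below_on H (\<lambda>x. T x - \<mu> *\<^sub>R x)"
proof -
  let ?B = "\<lambda>x. T x - \<mu> *\<^sub>R x"
  have "bounded_below_on H ?B" if R: "L2_bounded_operator V E m R"
    "\<forall>f\<in>L2G. R (\<lambda>v. lap f v - \<mu> * f v) = f \<and> (\<lambda>v. lap (R f) v - \<mu> * R f v) = f" for R
  proof -
    obtain C where C: "\<And>f. f \<in> L2G \<Longrightarrow> L2_norm V E m (R f) \<le> C * L2_norm V E m f"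
      using R(1) unfolding L2_bounded_operator_def by blast
    \<comment> \<open>The constant \<open>C\<close> of a bounded operator may fail to be positive;
      \<open>D\<close> is positive, so \<open>1 / D\<close> can serve as the lower bound.\<close>
    define D where "D = max C 1"
    have "norm x \<le> D * norm (?B x)" if x: "x \<in> H" for x
    proof -
      define f where "f = of_ell2 x"
      have f: "f \<in> L2G" "to_ell2 f = x" using x by (auto simp: f_def of_ell2_L2 to_ell2_of_ell2)
      let ?g = "\<lambda>v. lap f v - \<mu> * f v"
      have g: "?g \<in> L2G" by (rule laplacian_minus_L2[OF f(1)])
      have "norm x = L2_norm V E m (R ?g)" using R(2) f norm_to_ell2[OF f(1)] by simp
      also have "\<dots> \<le> C * L2_norm V E m ?g" by (rule C[OF g])
      also have "L2_norm V E m ?g = norm (?B x)"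
        using norm_to_ell2[OF g] to_ell2_laplacian_minus[OF f(1)] f by simp
      also have "C * norm (?B x) \<le> D * norm (?B x)" by (simp add: D_def mult_right_mono)
      finally show ?thesis .
    qed
    then have "\<forall>x\<in>H. 1 / D * norm x \<le> norm (?B x)" "1 / D > 0"
      by (auto simp: D_def field_simps)
    then show ?thesis unfolding bounded_below_on_def by blast
  qed
  moreover have "\<exists>R. L2_bounded_operator V E m R \<and>
      (\<forall>f\<in>L2G. R (\<lambda>v. lap f v - \<mu> * f v) = f \<and> (\<lambda>v. lap (R f) v - \<mu> * R f v) = f)"
    if bb: "bounded_below_on H ?B"
  proof -
    obtain k where k: "k > 0" "\<And>x. x \<in> H \<Longrightarrow> k * norm x \<le> norm (?B x)"
      using bb unfolding bounded_below_on_def by blast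
    have blB: "bounded_linear ?B"
      by (intro bounded_linear_sub bounded_linear_T bounded_linear_scaleR_right)
    have BH: "?B ` H \<subseteq> H"
      using T_in_H by (auto intro!: subspace_diff[OF subspace_H] subspace_scale[OF subspace_H])
    have symB: "?B x \<bullet> y = x \<bullet> ?B y" for x y
      by (simp add: inner_diff_left inner_diff_right T_sym)
    have surj: "\<exists>x\<in>H. ?B x = y" if "y \<in> H" for y
      by (rule symmetric_bounded_below_imp_surj[OF subspace_H complete_H blB BH symB bb that])
    have "\<exists>u\<in>L2G. (\<lambda>v. lap u v - \<mu> * u v) = f" if f: "f \<in> L2G" for f
    proof -
      obtain x where x: "x \<in> H" "?B x = to_ell2 f" using surj[OF to_ell2_in_H[OF f]] by blast
      have "to_ell2 (\<lambda>v. lap (of_ell2 x) v - \<mu> * of_ell2 x v) = to_ell2 f"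
        using to_ell2_laplacian_minus[OF of_ell2_L2[of x], of \<mu>] x by (simp add: to_ell2_of_ell2)
      then show ?thesis
        using to_ell2_inject[OF laplacian_minus_L2[OF of_ell2_L2] f] of_ell2_L2 by blast
    qed
    then obtain R where R: "\<And>f. f \<in> L2G \<Longrightarrow> R f \<in> L2G"
      "\<And>f. f \<in> L2G \<Longrightarrow> (\<lambda>v. lap (R f) v - \<mu> * R f v) = f" by metis
    have low: "k * L2_norm V E m f \<le> L2_norm V E m (\<lambda>v. lap f v - \<mu> * f v)" if f: "f \<in> L2G" for f
      using k(2)[OF to_ell2_in_H[OF f]] norm_to_ell2[OF f] norm_to_ell2[OF laplacian_minus_L2[OF f]]
      by (simp add: to_ell2_laplacian_minus[OF f])
    have inj: "f = g" if fg: "f \<in> L2G" "g \<in> L2G"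
      and eq: "(\<lambda>v. lap f v - \<mu> * f v) = (\<lambda>v. lap g v - \<mu> * g v)" for f g
    proof -
      have d: "to_ell2 f - to_ell2 g \<in> H" using fg to_ell2_in_H by (auto intro: subspace_diff[OF subspace_H])
      have "?B (to_ell2 f) = ?B (to_ell2 g)"
        using to_ell2_laplacian_minus[OF fg(1)] to_ell2_laplacian_minus[OF fg(2)] eq by metis
      then have "?B (to_ell2 f - to_ell2 g) = 0" using linear_diff[OF bounded_linear.linear[OF blB]] by simp
      then have "to_ell2 f - to_ell2 g = 0" using k(1) k(2)[OF d] by (simp add: mult_le_0_iff)
      then show ?thesis using to_ell2_inject fg by simp
    qed
    show ?thesis
    proof (intro exI[of _ R] conjI ballI)
      fix f assume f: "f \<in> L2G"
      show "(\<lambda>v. lap (R f) v - \<mu> * R f v) = f" by (rule R(2)[OF f])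
      show "R (\<lambda>v. lap f v - \<mu> * f v) = f"
        by (rule inj[OF R(1)[OF laplacian_minus_L2[OF f]] f R(2)[OF laplacian_minus_L2[OF f]]])
    next
      show "L2_bounded_operator V E m R"
        unfolding L2_bounded_operator_def
      proof (intro conjI ballI allI exI[of _ "1 / k"])
        fix f assume f: "f \<in> L2G"
        show "R f \<in> L2G" by (rule R(1)[OF f])
        show "L2_norm V E m (R f) \<le> 1 / k * L2_norm V E m f"
          using low[OF R(1)[OF f]] k(1) by (simp add: R(2)[OF f] field_simps)
      next
        fix f g a b assume fg: "f \<in> L2G" "g \<in> L2G"
        have Rfg: "R f \<in> L2G" "R g \<in> L2G" using fg R by auto
        show "R (\<lambda>v. a * f v + b * g v) = (\<lambda>v. a * R f v + b * R g v)"
        proof (rule inj)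
          show "R (\<lambda>v. a * f v + b * g v) \<in> L2G" by (intro R L2_lincomb fg)
          show "(\<lambda>v. a * R f v + b * R g v) \<in> L2G" by (intro L2_lincomb Rfg)
          have "(\<lambda>v. lap (\<lambda>v. a * R f v + b * R g v) v - \<mu> * (a * R f v + b * R g v)) =
              (\<lambda>v. a * (lap (R f) v - \<mu> * R f v) + b * (lap (R g) v - \<mu> * R g v))"
            unfolding laplacian_lincomb[OF Rfg] by (simp add: algebra_simps)
          also have "\<dots> = (\<lambda>v. a * f v + b * g v)"
            using fun_cong[OF R(2)[OF fg(1)]] fun_cong[OF R(2)[OF fg(2)]] by simp
          finally show "(\<lambda>v. lap (R (\<lambda>v. a * f v + b * g v)) v - \<mu> * R (\<lambda>v. a * f v + b * g v) v) =
              (\<lambda>v. lap (\<lambda>v. a * R f v + b * R g v) v - \<mu> * (a * R f v + b * R g v))"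
            using R(2)[OF L2_lincomb[OF fg]] by simp
        qed
      qed
    qed
  qed
  ultimately show ?thesis unfolding L2_spectrum_def by blast
qed

section \<open>The four inequalities\<close>

abbreviation spec :: "real set" where "spec \<equiv> L2_spectrum V E m lap"

text \<open>Constants and shifted test functions need not vanish outside \<open>V\<close>, as
  \<open>L2G\<close> demands; truncation changes neither \<open>N\<close> nor
  \<open>energy\<close>.\<close>

definition restrict_V :: "('v \<Rightarrow> real) \<Rightarrow> 'v \<Rightarrow> real" where
  "restrict_V f v = (if v \<in> V then f v else 0)"

lemma restrict_V_L2: "sq_summable f \<Longrightarrow> restrict_V f \<in> L2G"
  by (auto simp: L2_iff restrict_V_def intro: sq_summable_mono)

lemma N_restrict_V: "N (restrict_V f) = N f"
  unfolding N_def by (rule infsum_cong) (auto simp: restrict_V_def)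

lemma energy_restrict_V: "energy (restrict_V f) = energy f"
  unfolding energy_def
proof (rule infsum_cong)
  fix e show "p e * (restrict_V f (fst e) - restrict_V f (snd e))\<^sup>2 = p e * (f (fst e) - f (snd e))\<^sup>2"
    using p_outside[of "fst e" "snd e"] by (auto simp: restrict_V_def)
qed

text \<open>One spectral point that dominates all Rayleigh quotients yields the lower bound for
  \<open>lambda_top\<close> and shows that the spectrum and its positive part are nonempty, as the
  arguments with \<open>Sup\<close> and \<open>Inf\<close> require.\<close>

lemma spec_top_Rayleigh:
  "\<exists>s\<in>spec. \<forall>f. sq_summable f \<longrightarrow> energy f / 2 \<le> s * N f"
proof -
  have "N (\<lambda>_. 1) = W V" using W_V_has_sum by (simp add: N_def infsumI)
  then have "norm (to_ell2 (restrict_V (\<lambda>_. 1))) \<noteq> 0"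
    using norm_to_ell2_square[OF restrict_V_L2[OF sq_summable_const[of 1]]] W_pos[OF order_refl V_nonempty]
    by (auto simp: N_restrict_V)
  then have x0: "to_ell2 (restrict_V (\<lambda>_. 1)) \<noteq> 0" by auto
  obtain s where s: "\<And>x. x \<in> H \<Longrightarrow> T x \<bullet> x \<le> s * (norm x)\<^sup>2"
    and nb: "\<not> bounded_below_on H (\<lambda>x. T x - s *\<^sub>R x)"
    using form_Sup_not_bounded_below[OF subspace_H bounded_linear_T T_image T_sym
        to_ell2_in_H[OF restrict_V_L2[OF sq_summable_const]] x0] by blast
  show ?thesis
  proof (intro bexI[of _ s] allI impI)
    show "s \<in> spec" using nb by (simp add: spectrum_iff)
    fix f assume f: "sq_summable f"
    show "energy f / 2 \<le> s * N f"
      using s[OF to_ell2_in_H[OF restrict_V_L2[OF f]]] norm_to_ell2_square[OF restrict_V_L2[OF f]]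
      by (simp add: T_form of_ell2_to_ell2 restrict_V_L2[OF f] N_restrict_V energy_restrict_V)
  qed
qed

lemma spec_le: "\<mu> \<in> spec \<Longrightarrow> \<mu> \<le> 1 + sqrt (1 - (1 - hdual)\<^sup>2)"
proof (rule ccontr)
  assume "\<mu> \<in> spec" "\<not> \<mu> \<le> 1 + sqrt (1 - (1 - hdual)\<^sup>2)"
  moreover have "T x \<bullet> x \<le> (1 + sqrt (1 - (1 - hdual)\<^sup>2)) * (norm x)\<^sup>2" if "x \<in> H" for x
    using dual_cheeger_upper[of "of_ell2 x"] of_ell2_L2[of x] by (simp add: T_form norm_H that L2_iff)
  ultimately show False
    using bounded_below_above_form[of H T "1 + sqrt (1 - (1 - hdual)\<^sup>2)" \<mu>]
    by (simp add: spectrum_iff not_le)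
qed

lemma lambda_top_upper: "lambda_top V E m \<le> 1 + sqrt (1 - (1 - hdual)\<^sup>2)"
proof -
  have "spec \<noteq> {}" using spec_top_Rayleigh by blast
  then show ?thesis unfolding lambda_top_def by (intro cSup_least spec_le)
qed

lemma lambda_top_lower: "2 * hdual \<le> lambda_top V E m"
proof -
  obtain s where s: "s \<in> spec" "\<And>f. sq_summable f \<Longrightarrow> energy f / 2 \<le> s * N f"
    using spec_top_Rayleigh by blast
  have "hdual \<le> s / 2" unfolding dual_cheeger_constant_def
  proof (rule cSup_least[OF dual_ratios_nonempty])
    fix x assume "x \<in> dual_ratios"
    then obtain A B where AB: "A \<subseteq> V" "B \<subseteq> V" "A \<noteq> {}" "B \<noteq> {}" "A \<inter> B = {}"
      and x: "x = dual_cheeger_ratio V E m A B" by auto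
    note t = dual_test_function[OF AB(5)]
    have "4 * (\<Sum>\<^sub>\<infinity>e. p e * of_bool (fst e \<in> A \<and> snd e \<in> B)) \<le> s * (W A + W B)"
      using t(3) s(2)[OF t(1)] unfolding t(2) by linarith
    moreover have "0 < W A + W B" using W_pos[of A] W_pos[of B] AB by simp
    ultimately show "x \<le> s / 2" unfolding x dual_cheeger_ratio_eq[OF AB(5)] by (simp add: field_simps)
  qed
  also have "s \<le> lambda_top V E m" unfolding lambda_top_def
    by (intro cSup_upper s bdd_aboveI[of _ "1 + sqrt (1 - (1 - hdual)\<^sup>2)"] spec_le)
  finally show ?thesis by simp
qed

text \<open>The centred indicator of a vertex has positive energy because an edge leaves the vertex;
  a spectral point dominating its Rayleigh quotient is then positive.\<close>

lemma positive_spec_nonempty: "{\<mu> \<in> spec. \<mu> > 0} \<noteq> {}"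
proof -
  obtain s where s: "s \<in> spec" "\<And>f. sq_summable f \<Longrightarrow> energy f / 2 \<le> s * N f"
    using spec_top_Rayleigh by blast
  obtain v where v: "v \<in> V" using V_nonempty by blast
  obtain e where e: "e \<in> E" "v \<in> e" using v no_isolated by (auto simp: no_isolated_vertices_def)
  then obtain w where w: "e = {v, w}" "w \<noteq> v"
    by (metis edgeE insertE insert_commute singletonD)
  note t = cheeger_test_function[of "{v}"]
  have "0 < p (v, w)" using e w weight_pos by (simp add: p_def pair_weight_def)
  also have "p (v, w) \<le> bdry {v}"
    using finite_sum_le_infsum[OF p_indicator_summable, of "{(v, w)}" "\<lambda>e. fst e \<in> {v} \<and> snd e \<notin> {v}"] w
    by simp
  also have "\<dots> \<le> s * (W {v} * (1 - W {v} / W V))"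
    using s(2)[OF t(1)] t(3,4) v by simp
  finally have "0 < s * (W {v} * (1 - W {v} / W V))" .
  moreover have "0 \<le> W {v} * (1 - W {v} / W V)" using t(4) v N_nonneg by (metis empty_subsetI insert_subset)
  ultimately have "0 < s" using zero_less_mult_pos2 mult_nonpos_nonneg[of s] not_less by blast
  then show ?thesis using s(1) by blast
qed

definition one :: "'v ell2" where "one = to_ell2 (restrict_V (\<lambda>_. 1))"

lemma of_ell2_one: "of_ell2 one = restrict_V (\<lambda>_. 1)"
  by (simp add: one_def of_ell2_to_ell2 restrict_V_L2 sq_summable_const)

lemma one_H: "one \<in> H"
  by (simp add: one_def to_ell2_in_H restrict_V_L2 sq_summable_const)

lemma inner_one: "x \<bullet> one = (\<Sum>\<^sub>\<infinity>v. M v * of_ell2 x v)"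
proof -
  have "x \<bullet> one = ip (restrict_V (\<lambda>_. 1)) (of_ell2 x)"
    unfolding one_def by (simp add: inner_commute[of x] inner_to_ell2 restrict_V_L2 sq_summable_const)
  also have "\<dots> = (\<Sum>\<^sub>\<infinity>v. M v * of_ell2 x v)"
    unfolding L2_inner_eq by (rule infsum_cong) (simp add: restrict_V_def)
  finally show ?thesis .
qed

lemma T_one: "T one = 0"
proof -
  have "lap (restrict_V (\<lambda>_. 1)) v = 0" for v
  proof (cases "v \<in> V")
    case True
    have "(\<Sum>\<^sub>\<infinity>w. p (v, w) * restrict_V (\<lambda>_. 1) w) = (\<Sum>\<^sub>\<infinity>w. p (v, w))"
      by (rule infsum_cong) (auto simp: restrict_V_def p_outside)
    then have "avg (restrict_V (\<lambda>_. 1)) v = 1"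
      using M_pos[OF True] by (simp add: avg_def infsumI[OF p_section_has_sum])
    then show ?thesis using True by (simp add: laplacian_eq restrict_V_def)
  qed (simp add: laplacian_outside)
  then have "lap (restrict_V (\<lambda>_. 1)) = (\<lambda>_. 0)" by auto
  moreover have "to_ell2 (\<lambda>_. 0) = 0"
    using sq_summable_const[of 0] by (intro ell2_eqI) (simp add: nth_to_ell2)
  ultimately show ?thesis by (simp add: T_def of_ell2_one)
qed

lemma one_nonzero: "one \<noteq> 0"
proof -
  have "one \<bullet> one = W V"
    unfolding inner_one of_ell2_one infsumI[OF W_V_has_sum, symmetric]
    by (rule infsum_cong) (simp add: restrict_V_def)
  then show ?thesis using W_pos[OF order_refl V_nonempty] by auto
qed

lemma lambda_gap_lower: "1 - sqrt (1 - h\<^sup>2) \<le> lambda_gap V E m"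
  unfolding lambda_gap_def
proof (rule cInf_greatest[OF positive_spec_nonempty], rule ccontr)
  fix \<mu> assume \<mu>: "\<mu> \<in> {\<mu> \<in> spec. \<mu> > 0}" "\<not> 1 - sqrt (1 - h\<^sup>2) \<le> \<mu>"
  have "(1 - sqrt (1 - h\<^sup>2)) * (norm x)\<^sup>2 \<le> T x \<bullet> x" if "x \<in> H" "x \<bullet> one = 0" for x
    using cheeger_Poincare[of "of_ell2 x"] of_ell2_L2[of x] that
    by (simp add: T_form norm_H L2_iff inner_one)
  then have "bounded_below_on H (\<lambda>x. T x - \<mu> *\<^sub>R x)"
    using \<mu> by (intro bounded_below_off_kernel_vector[OF subspace_H bounded_linear_T T_sym
        one_H one_nonzero T_one]) auto
  then show False using \<mu> by (simp add: spectrum_iff)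
qed

text \<open>Zero energy forces equal values at the ends of every edge, hence along paths. This is
  the step that uses connectedness.\<close>

lemma kernel_constant:
  assumes conn: "connected_graph V E" and y: "y \<in> H" "T y = 0"
  obtains c where "y = c *\<^sub>R one"
proof -
  let ?f = "of_ell2 y"
  have f: "sq_summable ?f" using of_ell2_L2[of y] by (simp add: L2_iff)
  have "energy ?f = 0" using T_form[of y] y by simp
  then have zero: "p e * (?f (fst e) - ?f (snd e))\<^sup>2 = 0" for e
    using has_sum_imp_summable[OF energy_has_sum(1)[OF f]]
    by (intro nonneg_infsum_le_0D[of _ UNIV]) (auto simp: energy_def)
  have edge: "?f u = ?f w" if "{u, w} \<in> E" for u w
    using zero[of "(u, w)"] weight_pos[OF that] that by (simp add: p_def pair_weight_def)
  have path: "?f u = ?f w" if "(u, w) \<in> {(x, y). {x, y} \<in> E}\<^sup>*" for u w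
    using that by (induction rule: rtrancl_induct) (auto simp: edge)
  obtain v where v: "v \<in> V" using V_nonempty by blast
  have "?f = (\<lambda>u. ?f v * of_ell2 one u + 0 * of_ell2 one u)"
  proof
    fix u
    show "?f u = ?f v * of_ell2 one u + 0 * of_ell2 one u"
    proof (cases "u \<in> V")
      case True
      then have "?f u = ?f v" using conn v path unfolding connected_graph_def by blast
      then show ?thesis using True by (simp add: of_ell2_one restrict_V_def)
    next
      case False
      then show ?thesis using of_ell2_L2[of y] by (simp add: of_ell2_one restrict_V_def L2_iff)
    qed
  qed
  then have "to_ell2 ?f = ?f v *\<^sub>R to_ell2 (of_ell2 one) + 0 *\<^sub>R to_ell2 (of_ell2 one)"
    using to_ell2_lincomb[OF of_ell2_L2 of_ell2_L2, of "?f v" one 0 one] by (simp only:)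
  then have "y = ?f v *\<^sub>R one" using y one_H by (simp add: to_ell2_of_ell2)
  then show ?thesis by (rule that)
qed

lemma lambda_gap_upper:
  assumes conn: "connected_graph V E"
  shows "lambda_gap V E m \<le> 2 * h"
\<comment> \<open>If the positive spectrum accumulates at 0 the bound is trivial; otherwise the open
  interval from 0 to the gap is free of spectrum, as \<open>spectral_gap_orthogonal_kernel\<close>
  requires.\<close>
proof (cases "lambda_gap V E m > 0")
  case False
  then show ?thesis using cheeger_constant_bounds by simp
next
  case True
  let ?\<epsilon> = "lambda_gap V E m"
  have gap: "bounded_below_on H (\<lambda>x. T x - \<mu> *\<^sub>R x)" if "0 < \<mu>" "\<mu> < ?\<epsilon>" for \<mu>
  proof (rule ccontr)
    assume "\<not> bounded_below_on H (\<lambda>x. T x - \<mu> *\<^sub>R x)"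
    then have "?\<epsilon> \<le> \<mu>" unfolding lambda_gap_def
      using that by (intro cInf_lower bdd_belowI[of _ 0]) (auto simp: spectrum_iff)
    then show False using that by simp
  qed
  have pos: "0 \<le> T x \<bullet> x" for x by (simp add: T_form)
  have "?\<epsilon> / 2 \<le> h" unfolding cheeger_constant_def
  proof (rule cInf_greatest)
    show "{cheeger_ratio V E m S | S. S \<subseteq> V \<and> S \<noteq> {} \<and> W S \<le> W (V - S)} \<noteq> {}"
      using cheeger_admissible_exists by auto
    fix r assume "r \<in> {cheeger_ratio V E m S | S. S \<subseteq> V \<and> S \<noteq> {} \<and> W S \<le> W (V - S)}"
    then obtain S where S: "S \<subseteq> V" "S \<noteq> {}" "W S \<le> W (V - S)" and r: "r = cheeger_ratio V E m S"
      by auto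
    define f where "f v = of_bool (v \<in> S) - W S / W V" for v
    note t = cheeger_test_function[OF S(1), folded f_def]
    define x where "x = to_ell2 (restrict_V f)"
    have x: "x \<in> H" and fx: "of_ell2 x = restrict_V f"
      using t(1) by (auto simp: x_def to_ell2_in_H of_ell2_to_ell2 restrict_V_L2)
    have "x \<bullet> one = (\<Sum>\<^sub>\<infinity>v. M v * f v)"
      unfolding inner_one fx by (rule infsum_cong) (simp add: restrict_V_def)
    then have "x \<bullet> one = 0" using t(2) by simp
    then have perp: "x \<bullet> y = 0" if y: "y \<in> H" "T y = 0" for y
      using kernel_constant[OF conn y] by force
    have "?\<epsilon> * (norm x)\<^sup>2 \<le> T x \<bullet> x"
      by (rule spectral_gap_orthogonal_kernel[OF subspace_H complete_H bounded_linear_T T_image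
          T_sym pos True gap x perp])
    then have le: "?\<epsilon> * (W S * (1 - W S / W V)) \<le> bdry S"
      unfolding norm_H[OF x] T_form fx N_restrict_V energy_restrict_V t(3,4) .
    have WS: "0 < W S" and WV: "0 < W V" using W_pos S V_nonempty by auto
    \<comment> \<open>Admissibility of \<open>S\<close> enters here: projecting the indicator off
      the constants keeps at least half of its squared norm \<open>W S\<close>, and this half is the
      source of the 2 in the bound.\<close>
    have "W S / W V \<le> 1 / 2" using S WV by (simp add: W_Diff field_simps)
    then have "?\<epsilon> * (W S * (1 / 2)) \<le> ?\<epsilon> * (W S * (1 - W S / W V))"
      using True WS by (intro mult_left_mono) auto
    with le have "?\<epsilon> * (W S * (1 / 2)) \<le> bdry S" by (rule order_trans[rotated])
    then show "?\<epsilon> / 2 \<le> r" using WS by (simp add: r cheeger_ratio_eq field_simps)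
  qed
  then show ?thesis by linarith
qed

end

theorem theorem5p1:
  fixes V :: "'v set" and E :: "'v set set" and m :: "'v set \<Rightarrow> real"
  assumes "summable_weighted_graph V E m"
    and "V \<noteq> {}"
    and "no_isolated_vertices V E"
  shows "1 - sqrt (1 - (cheeger_constant V E m)\<^sup>2) \<le> lambda_gap V E m \<and>
         (connected_graph V E \<longrightarrow> lambda_gap V E m \<le> 2 * cheeger_constant V E m) \<and>
         2 * dual_cheeger_constant V E m \<le> lambda_top V E m \<and>
         lambda_top V E m \<le> 1 + sqrt (1 - (1 - dual_cheeger_constant V E m)\<^sup>2)"
proof -
  interpret nonisolated_weighted_graph V E m
    using assms by (simp add: nonisolated_weighted_graph_def nonisolated_weighted_graph_axioms_def)
  show ?thesis by (intro conjI impI lambda_gap_lower lambda_gap_upper lambda_top_lower lambda_top_upper)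
qed

end
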